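(* For every fixed $t\ge 0$, if $r_0\le 0$ then the map $(q,r,s)\mapsto(x,y,z)$ given by \[ x=q-\frac1k e^{k[r-f(s)]}\sin[k(q-ct)],\qquad y=s,\qquad z=r+\frac1k e^{k[r-f(s)]}\cos[k(q-ct)] \] is a global diffeomorphism from \[ \mathcal V=\{(q,r,s): q\in\mathbb R,\ r<r_0,\ s\in\mathbb R\} \] into the fluid domain beneath the free surface $z=\eta(x,y,t)$. Moreover, if $r_0<0$ the free surface $z=\eta(x,y,t)$ has a smooth profile, and in the limiting case $r_0=0$ the free surface is piecewise smooth with upward cusps at $s=0$.
   Context: Constants: $\Omega>0$ (rotation speed of the earth, $73\cdot10^{-6}$ rad/s), $g>0$ (gravitational constant, $9.8$ m/s$^2$), $R>0$ (radius of the earth, $6378$ km), $\beta=2\Omega/R$, and $k=2\pi/L>0$ is the wave number, where $L>0$ is the wavelength. The wave speed is $c=\dfrac{\sqrt{\Omega^2+kg}-\Omega}{k}$, and $f(s)=\dfrac{c\beta}{2g}s^2$ for $s\in\mathbb R$. The number $r_0\le 0$ is a fixed constant, and it is this constant that appears in the definition of $\mathcal V$. For each $s\in\mathbb R$, $r_0(s)\le r_0$ denotes the unique solution of \[ \frac{e^{2k[r_0(s)-f(s)]}}{2k}-r_0(s)=\frac{e^{2kr_0}}{2k}-r_0 . \] The free surface $z=\eta(x,y,t)$ at time $t$ is obtained, at each fixed latitude $s$, by setting $r=r_0(s)$ in the map, i.e. it is the surface parametrized by \[ (q,s)\mapsto\Big(q-\tfrac1k e^{k[r_0(s)-f(s)]}\sin[k(q-ct)],\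 s,\ r_0(s)+\tfrac1k e^{k[r_0(s)-f(s)]}\cos[k(q-ct)]\Big),\quad (q,s)\in\mathbb R^2 . \] The fluid domain is the region of $(x,y,z)$-space lying beneath this surface.
   Formalization: For s≠0 one has r_0(s)<r_0, so V is not mapped into the fluid domain; instead the map is shown to be a diffeomorphism of V onto its open image, and of the part r<r_0(s) of V onto the fluid domain. *)

theory Defs
  imports "HOL-Analysis.Analysis"
begin

text \<open>
  Smoothness is \<open>C\<^sup>\<infinity>\<close>. On an open set of a finite-dimensional space, \<open>f\<close> is of class
  \<open>n + 1\<close> iff it is differentiable and all its directional derivatives are of class \<open>n\<close>.
  On an arbitrary set (e.g. a closed half-plane, where it means smooth up to the boundary)
  smoothness is local extendability to a smooth function.
\<close>

primrec Ck_on :: "nat \<Rightarrow> 'a::euclidean_space set \<Rightarrow> ('a \<Rightarrow> 'b::real_normed_vector) \<Rightarrow> bool" where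
  "Ck_on 0 U f \<longleftrightarrow> continuous_on U f"
| "Ck_on (Suc n) U f \<longleftrightarrow>
     (\<forall>x\<in>U. f differentiable (at x)) \<and> (\<forall>v. Ck_on n U (\<lambda>x. frechet_derivative f (at x) v))"

definition smooth_on :: "'a::euclidean_space set \<Rightarrow> ('a \<Rightarrow> 'b::real_normed_vector) \<Rightarrow> bool" where
  "smooth_on S f \<longleftrightarrow>
     (\<forall>x\<in>S. \<exists>U g. open U \<and> x \<in> U \<and> (\<forall>n. Ck_on n U g) \<and> (\<forall>y\<in>U \<inter> S. g y = f y))"

definition diffeomorphism_on ::
    "'a::euclidean_space set \<Rightarrow> 'b::euclidean_space set \<Rightarrow> ('a \<Rightarrow> 'b) \<Rightarrow> bool" where
  "diffeomorphism_on U W f \<longleftrightarrow>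
     open U \<and> open W \<and> bij_betw f U W \<and> smooth_on U f \<and> smooth_on W (inv_into U f)"

definition upward_cusp :: "(real \<Rightarrow> real) \<Rightarrow> real \<Rightarrow> bool" where
  "upward_cusp h a \<longleftrightarrow>
     isCont h a \<and> (\<forall>\<^sub>F x in at a. h differentiable (at x)) \<and>
     filterlim (deriv h) at_top (at_left a) \<and> filterlim (deriv h) at_bot (at_right a)"

text \<open>Labels are ordered \<open>(q, r, s)\<close>, positions \<open>(x, y, z)\<close>.\<close>

definition flow_map ::
    "real \<Rightarrow> real \<Rightarrow> (real \<Rightarrow> real) \<Rightarrow> real \<Rightarrow> real \<times> real \<times> real \<Rightarrow> real \<times> real \<times> real" where
  "flow_map k c f t = (\<lambda>(q, r, s).
     (q - (1 / k) * exp (k * (r - f s)) * sin (k * (q - c * t)),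
      s,
      r + (1 / k) * exp (k * (r - f s)) * cos (k * (q - c * t))))"

definition label_domain :: "real \<Rightarrow> (real \<times> real \<times> real) set" where
  "label_domain r0 = {(q, r, s). r < r0}"

text \<open>The function \<open>s \<mapsto> r\<^sub>0(s)\<close>; the lemma shows that the description is proper.\<close>

definition surface_label :: "real \<Rightarrow> (real \<Rightarrow> real) \<Rightarrow> real \<Rightarrow> real \<Rightarrow> real" where
  "surface_label k f r0 s =
     (THE \<rho>. \<rho> \<le> r0 \<and> exp (2 * k * (\<rho> - f s)) / (2 * k) - \<rho> = exp (2 * k * r0) / (2 * k) - r0)"

lemma surface_label_unique:
  fixes k r0 s :: real
  assumes k: "k > 0" and r0: "r0 \<le> 0" and fs: "f s \<ge> 0"
  shows "\<exists>!\<rho>. \<rho> \<le> r0 \<and> exp (2 * k * (\<rho> - f s)) / (2 * k) - \<rho> = exp (2 * k * r0) / (2 * k) - r0"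
proof -
  define G where "G \<rho> = exp (2 * k * (\<rho> - f s)) / (2 * k) - \<rho>" for \<rho>
  define C where "C = exp (2 * k * r0) / (2 * k) - r0"
  have strict: "G b < G a" if "a < b" "b \<le> r0" for a b
  proof (rule DERIV_neg_imp_decreasing_open[OF \<open>a < b\<close>])
    fix x assume x: "a < x" "x < b"
    have "(G has_real_derivative exp (2 * k * (x - f s)) - 1) (at x)"
      unfolding G_def using k by (auto intro!: derivative_eq_intros)
    moreover have "exp (2 * k * (x - f s)) - 1 < 0"
      using x that r0 fs k by (simp add: mult_pos_neg)
    ultimately show "\<exists>y. (G has_real_derivative y) (at x) \<and> y < 0" by blast
  qed (use k in \<open>auto simp: G_def intro!: continuous_intros\<close>)
  have hi: "G r0 \<le> C"
    unfolding G_def C_def using k fs by (simp add: divide_right_mono)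
  have lo: "C \<le> G (min r0 (- C))"
  proof -
    have "G (min r0 (- C)) \<ge> - min r0 (- C)" unfolding G_def using k by simp
    then show ?thesis by linarith
  qed
  have "\<exists>x. min r0 (- C) \<le> x \<and> x \<le> r0 \<and> G x = C"
    by (rule IVT2') (use hi lo k in \<open>auto simp: G_def intro!: continuous_intros\<close>)
  then obtain x where "x \<le> r0" "G x = C" by blast
  moreover have "y = x" if "y \<le> r0" "G y = C" for y
    using strict[of x y] strict[of y x] that \<open>x \<le> r0\<close> \<open>G x = C\<close> by linarith
  ultimately show ?thesis unfolding G_def C_def by blast
qed

definition free_surface ::
    "real \<Rightarrow> real \<Rightarrow> (real \<Rightarrow> real) \<Rightarrow> real \<Rightarrow> real \<Rightarrow> (real \<times> real \<times> real) set" where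
  "free_surface k c f r0 t = range (\<lambda>(q, s). flow_map k c f t (q, surface_label k f r0 s, s))"

definition fluid_domain ::
    "real \<Rightarrow> real \<Rightarrow> (real \<Rightarrow> real) \<Rightarrow> real \<Rightarrow> real \<Rightarrow> (real \<times> real \<times> real) set" where
  "fluid_domain k c f r0 t = {(x, y, z). \<exists>z'. (x, y, z') \<in> free_surface k c f r0 t \<and> z < z'}"

text \<open>
  The labels in \<open>label_domain r0\<close> lying below the free surface at their latitude. Since
  \<open>r\<^sub>0(s) < r\<^sub>0\<close> whenever \<open>f s > 0\<close>, this is in general a proper subset of \<open>label_domain r0\<close>: a label
  with \<open>r\<^sub>0(s) \<le> r < r\<^sub>0\<close> is mapped onto or above the free surface, so the flow map does not send the
  whole of \<open>label_domain r0\<close> into the fluid domain.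
\<close>

definition fluid_labels :: "real \<Rightarrow> (real \<Rightarrow> real) \<Rightarrow> real \<Rightarrow> (real \<times> real \<times> real) set" where
  "fluid_labels k f r0 = {(q, r, s) \<in> label_domain r0. r < surface_label k f r0 s}"

end

theory Submission
  imports Defs "HOL-Real_Asymp.Real_Asymp"
begin

text \<open>
  With \<open>\<theta> = k (q - c t)\<close> and \<open>e = exp (k (r - f s))\<close> the first component of the flow map becomes Kepler's
  equation \<open>k (x - c t) = \<theta> - e sin \<theta>\<close>. All labels in question satisfy \<open>r \<le> f s\<close>, hence \<open>0 < e \<le> 1\<close>, and
  Kepler's equation is uniquely solvable for \<open>\<theta>\<close> (\<open>kepler\<close>). Therefore the particles with given \<open>r\<close> and
  \<open>s\<close> form a graph over the \<open>x\<close>-axis, whose height is, up to scaling and translation, the function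
  \<open>trochoid\<close>.

  The displacement of particles at one latitude is, up to an isometry, the complex exponential on the
  closed left half plane, which strictly contracts distances (\<open>exp_polar_contraction\<close>). So the heights
  of the graphs for different \<open>r\<close> never agree, they increase with \<open>r\<close>, and they sweep exactly the
  region below the surface (\<open>trochoid_below_iff\<close>). This gives injectivity of the flow map and identifies
  its image. The Jacobian determinant \<open>1 - e\<^sup>2\<close> is positive for \<open>r < f s\<close>, and an inverse function
  theorem for class \<open>C\<^sup>\<infinity>\<close> (\<open>diffeomorphism_onI\<close>) makes the flow map a diffeomorphism.

  The surface is the graph for \<open>r = r\<^sub>0(s)\<close>. Its height is smooth wherever \<open>s \<mapsto> r\<^sub>0(s)\<close> is smooth and
  \<open>1 - e cos \<theta> > 0\<close>. With \<open>w = 2 k (r\<^sub>0(s) - f s)\<close> the equation for \<open>r\<^sub>0(s)\<close> reads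
  \<open>exp w - 1 - w = const + 2 k f s\<close>, where the constant is positive for \<open>r\<^sub>0 < 0\<close> and \<open>0\<close> for \<open>r\<^sub>0 = 0\<close>. The left
  hand side has a nondegenerate minimum at \<open>w = 0\<close>. Straightening this fold (\<open>exp_fold_inverse\<close>) shows
  that \<open>w\<close> is a smooth function of \<open>- sqrt (2 const + 4 k f s)\<close>, which is smooth in \<open>s\<close> if \<open>const > 0\<close> and a
  multiple of \<open>\<bar>s\<bar>\<close> if \<open>const = 0\<close>. In the latter case the surface is smooth up to \<open>s = 0\<close> from both sides,
  except for the points of the equator with \<open>\<theta> \<in> 2 \<pi> \<int>\<close>; the equatorial cross-section is the cycloid,
  which has its cusps there (\<open>upward_cusp_cycloid\<close>).
\<close>

section \<open>Calculus of smooth functions\<close>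

lemma Ck_on_cong:
  assumes "Ck_on n U f" "open U" "\<And>x. x \<in> U \<Longrightarrow> f x = g x"
  shows "Ck_on n U g"
  using assms
proof (induction n arbitrary: f g)
  case 0
  then show ?case by (simp cong: continuous_on_cong)
next
  case (Suc n)
  have der: "(g has_derivative frechet_derivative f (at x)) (at x)" if "x \<in> U" for x
    using Suc.prems that
    by (auto intro: has_derivative_transform_within_open[of f] simp: frechet_derivative_works)
  have eq: "frechet_derivative f (at x) = frechet_derivative g (at x)" if "x \<in> U" for x
    using der[OF that] by (rule frechet_derivative_at)
  have "Ck_on n U (\<lambda>x. frechet_derivative g (at x) v)" for v
    by (rule Suc.IH[of "\<lambda>x. frechet_derivative f (at x) v"]) (use Suc.prems eq in simp_all)
  with der show ?case
    unfolding Ck_on.simps differentiable_def by (intro conjI ballI allI exI)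
qed

lemma Ck_on_SucI:
  assumes "open U" "\<And>x. x \<in> U \<Longrightarrow> (f has_derivative f' x) (at x)" "\<And>v. Ck_on n U (\<lambda>x. f' x v)"
  shows "Ck_on (Suc n) U f"
proof -
  have "f' x = frechet_derivative f (at x)" if "x \<in> U" for x
    using assms(2)[OF that] by (rule frechet_derivative_at)
  then have "Ck_on n U (\<lambda>x. frechet_derivative f (at x) v)" for v
    by (intro Ck_on_cong[OF assms(3) assms(1)]) auto
  then show ?thesis using assms(2) by (auto simp: differentiable_def)
qed

lemma Ck_on_SucD:
  "Ck_on (Suc n) U f \<Longrightarrow> x \<in> U \<Longrightarrow> (f has_derivative frechet_derivative f (at x)) (at x)"
  by (simp add: frechet_derivative_works)

lemma Ck_on_Suc_imp: "Ck_on (Suc n) U f \<Longrightarrow> Ck_on n U f"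
proof (induction n arbitrary: f)
  case 0
  then show ?case
    by (auto intro!: continuous_at_imp_continuous_on differentiable_imp_continuous_within)
next
  case (Suc n)
  then show ?case by (metis Ck_on.simps(2))
qed

lemma Ck_on_subset: "Ck_on n U f \<Longrightarrow> V \<subseteq> U \<Longrightarrow> Ck_on n V f"
  by (induction n arbitrary: f) (auto intro: continuous_on_subset)

lemma Ck_on_local:
  assumes "\<And>x. x \<in> U \<Longrightarrow> \<exists>V. open V \<and> x \<in> V \<and> Ck_on n V f"
  shows "Ck_on n U f"
  using assms
proof (induction n arbitrary: f)
  case 0
  show ?case
    unfolding Ck_on.simps
  proof (rule continuous_at_imp_continuous_on, rule ballI)
    fix x assume "x \<in> U"
    then obtain V where "open V" "x \<in> V" "continuous_on V f" using 0 by auto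
    then show "isCont f x" by (simp add: continuous_on_eq_continuous_at)
  qed
next
  case (Suc n)
  have "Ck_on n U (\<lambda>x. frechet_derivative f (at x) v)" for v
    by (rule Suc.IH) (use Suc.prems in fastforce)
  then show ?case using Suc.prems by fastforce
qed

lemma Ck_on_const: "Ck_on n U (\<lambda>x. c)"
proof (induction n arbitrary: c)
  case (Suc n)
  then show ?case by simp
qed simp

lemma Ck_on_bounded_linear:
  assumes "bounded_linear f" "open U" shows "Ck_on n U f"
proof (cases n)
  case 0
  then show ?thesis using assms by (simp add: linear_continuous_on)
next
  case (Suc m)
  show ?thesis unfolding Suc
    by (rule Ck_on_SucI[OF assms(2), where f' = "\<lambda>_. f"])
      (auto intro: bounded_linear_imp_has_derivative assms Ck_on_const)
qed

lemma Ck_on_add: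
  assumes "open U" "Ck_on n U f" "Ck_on n U g"
  shows "Ck_on n U (\<lambda>x. f x + g x)"
  using assms(2,3)
proof (induction n arbitrary: f g)
  case 0
  then show ?case by (simp add: continuous_on_add)
next
  case (Suc n)
  show ?case
  proof (rule Ck_on_SucI[OF assms(1)])
    show "((\<lambda>x. f x + g x) has_derivative
        (\<lambda>v. frechet_derivative f (at x) v + frechet_derivative g (at x) v)) (at x)"
      if "x \<in> U" for x
      using Ck_on_SucD[OF Suc.prems(1) that] Ck_on_SucD[OF Suc.prems(2) that]
      by (rule has_derivative_add)
  qed (use Suc in auto)
qed

lemma Ck_on_sum:
  assumes "open U" "finite I" "\<And>i. i \<in> I \<Longrightarrow> Ck_on n U (f i)"
  shows "Ck_on n U (\<lambda>x. \<Sum>i\<in>I. f i x)"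
  using assms(2,3)
  by (induction I rule: finite_induct) (auto intro: Ck_on_const Ck_on_add[OF assms(1)])

lemma Ck_on_linear_image:
  assumes "bounded_linear h" "open U" "Ck_on n U f"
  shows "Ck_on n U (\<lambda>x. h (f x))"
  using assms(3)
proof (induction n arbitrary: f)
  case 0
  then show ?case
    by (simp add: bounded_linear.continuous_on[OF assms(1)])
next
  case (Suc n)
  show ?case
  proof (rule Ck_on_SucI[OF assms(2)])
    show "((\<lambda>x. h (f x)) has_derivative (\<lambda>v. h (frechet_derivative f (at x) v))) (at x)"
      if "x \<in> U" for x
      using Ck_on_SucD[OF Suc.prems that] by (rule bounded_linear.has_derivative[OF assms(1)])
  qed (use Suc in auto)
qed

lemma Ck_on_bilinear:
  assumes "bounded_bilinear h" "open U" "Ck_on n U f" "Ck_on n U g"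
  shows "Ck_on n U (\<lambda>x. h (f x) (g x))"
  using assms(3,4)
proof (induction n arbitrary: f g)
  case 0
  then show ?case by (simp add: bounded_bilinear.continuous_on[OF assms(1)])
next
  case (Suc n)
  show ?case
  proof (rule Ck_on_SucI[OF assms(2)])
    show "((\<lambda>x. h (f x) (g x)) has_derivative
        (\<lambda>v. h (f x) (frechet_derivative g (at x) v) + h (frechet_derivative f (at x) v) (g x))) (at x)"
      if "x \<in> U" for x
      using Ck_on_SucD[OF Suc.prems(1) that] Ck_on_SucD[OF Suc.prems(2) that]
      by (rule bounded_bilinear.FDERIV[OF assms(1)])
    show "Ck_on n U (\<lambda>x. h (f x) (frechet_derivative g (at x) v)
        + h (frechet_derivative f (at x) v) (g x))" for v
      using Suc.prems Ck_on_Suc_imp[OF Suc.prems(1)] Ck_on_Suc_imp[OF Suc.prems(2)]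
      by (intro Ck_on_add[OF assms(2)] Suc.IH) auto
  qed
qed

text \<open>The derivative of \<open>g \<circ> f\<close> at \<open>x\<close> in direction \<open>v\<close> takes \<open>g\<close>'s derivative in a direction that
  itself depends on \<open>x\<close>. Expanding that direction in the basis leaves only derivatives of \<open>g\<close> in fixed
  directions, to which the induction hypothesis applies.\<close>

lemma Ck_on_compose:
  fixes f :: "'a::euclidean_space \<Rightarrow> 'b::euclidean_space" and g :: "'b \<Rightarrow> 'c::real_normed_vector"
  assumes "open U" "Ck_on n U f" "Ck_on n V g" "f ` U \<subseteq> V"
  shows "Ck_on n U (\<lambda>x. g (f x))"
  using assms(2,3)
proof (induction n arbitrary: g)
  case 0
  then show ?case using assms(4) by (auto intro: continuous_on_compose2)
next
  case (Suc n)
  show ?case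
  proof (rule Ck_on_SucI[OF assms(1)])
    fix x assume x: "x \<in> U"
    let ?f' = "frechet_derivative f (at x)" and ?g' = "frechet_derivative g (at (f x))"
    have g': "(g has_derivative ?g') (at (f x))"
      using Ck_on_SucD[OF Suc.prems(2)] x assms(4) by blast
    then have "linear ?g'" by (simp add: has_derivative_linear)
    then have expand: "?g' w = (\<Sum>b\<in>Basis. (w \<bullet> b) *\<^sub>R ?g' b)" for w
      using linear_sum[of ?g' "\<lambda>b. (w \<bullet> b) *\<^sub>R b" Basis]
      by (simp add: euclidean_representation linear_scale)
    show "((\<lambda>x. g (f x)) has_derivative
        (\<lambda>v. \<Sum>b\<in>Basis. (frechet_derivative f (at x) v \<bullet> b) *\<^sub>R frechet_derivative g (at (f x)) b)) (at x)"
      unfolding expand[symmetric]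
      using Ck_on_SucD[OF Suc.prems(1) x] g' by (rule has_derivative_compose)
  next
    fix v
    show "Ck_on n U (\<lambda>x. \<Sum>b\<in>Basis.
        (frechet_derivative f (at x) v \<bullet> b) *\<^sub>R frechet_derivative g (at (f x)) b)"
      using Suc.prems Ck_on_Suc_imp[OF Suc.prems(1)]
      by (intro Ck_on_sum Ck_on_bilinear[OF bounded_bilinear_scaleR] assms(1) Suc.IH
          Ck_on_linear_image[OF bounded_linear_inner_left]) auto
  qed
qed

lemma Ck_on_Pair:
  assumes "open U" "Ck_on n U f" "Ck_on n U g"
  shows "Ck_on n U (\<lambda>x. (f x, g x))"
proof -
  have "Ck_on n U (\<lambda>x. (f x, 0) + (0, g x))"
    by (intro Ck_on_add Ck_on_linear_image[where h = "\<lambda>u. (u, 0)"]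
        Ck_on_linear_image[where h = "\<lambda>u. (0, u)"] bounded_linear_Pair
        bounded_linear_ident bounded_linear_zero assms)
  then show ?thesis by simp
qed

lemma smooth_onI:
  assumes "\<And>x. x \<in> S \<Longrightarrow>
    \<exists>U g. open U \<and> x \<in> U \<and> (\<forall>n. Ck_on n U g) \<and> (\<forall>y\<in>U \<inter> S. g y = f y)"
  shows "smooth_on S f"
  unfolding smooth_on_def using assms by (rule ballI)

lemma smooth_onE:
  assumes "smooth_on S f" "x \<in> S"
  obtains U g where "open U" "x \<in> U" "\<forall>n. Ck_on n U g" "\<forall>y\<in>U \<inter> S. g y = f y"
  using bspec[OF assms(1)[unfolded smooth_on_def] assms(2)] by (elim exE conjE) auto

lemma smooth_on_open_iff:
  assumes "open U" shows "smooth_on U f \<longleftrightarrow> (\<forall>n. Ck_on n U f)"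
proof
  assume L: "smooth_on U f"
  show "\<forall>n. Ck_on n U f"
  proof (intro allI Ck_on_local)
    fix n x assume "x \<in> U"
    with L obtain V g where V: "open V" "x \<in> V" "\<forall>n. Ck_on n V g"
      "\<forall>y\<in>V \<inter> U. g y = f y"
      by (rule smooth_onE)
    have "Ck_on n (V \<inter> U) f"
      by (rule Ck_on_cong[OF Ck_on_subset[of n V g]]) (use V assms in auto)
    then show "\<exists>V. open V \<and> x \<in> V \<and> Ck_on n V f"
      using V assms \<open>x \<in> U\<close> by (intro exI[of _ "V \<inter> U"]) auto
  qed
next
  assume "\<forall>n. Ck_on n U f"
  then show "smooth_on U f"
    using assms by (intro smooth_onI exI[of _ U] exI[of _ f]) simp
qed

lemma smooth_on_cong:
  assumes "smooth_on S f" "\<And>x. x \<in> S \<Longrightarrow> f x = g x" shows "smooth_on S g"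
proof (rule smooth_onI)
  fix x assume "x \<in> S"
  with assms(1) obtain U h where "open U" "x \<in> U" "\<forall>n. Ck_on n U h"
      "\<forall>y\<in>U \<inter> S. h y = f y"
    by (rule smooth_onE)
  with assms(2) show "\<exists>U h. open U \<and> x \<in> U \<and> (\<forall>n. Ck_on n U h) \<and> (\<forall>y\<in>U \<inter> S. h y = g y)"
    by (intro exI[of _ U] exI[of _ h]) auto
qed

lemma smooth_on_UNIVI: "(\<And>n. Ck_on n UNIV f) \<Longrightarrow> smooth_on S f"
  by (intro smooth_onI exI[of _ UNIV] exI[of _ f]) simp

lemma smooth_on_imp_continuous_on:
  assumes "smooth_on S f" shows "continuous_on S f"
  unfolding continuous_on_eq_continuous_within
proof
  fix x assume x: "x \<in> S"
  with assms obtain U g where U: "open U" "x \<in> U" "\<forall>n. Ck_on n U g"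
      "\<forall>y\<in>U \<inter> S. g y = f y"
    by (rule smooth_onE)
  have "continuous_on U g" using U(3)[rule_format, of 0] by simp
  then have "continuous (at x within S) g"
    using U(1,2) by (simp add: continuous_on_eq_continuous_at continuous_at_imp_continuous_at_within)
  moreover have "eventually (\<lambda>y. y \<in> U) (nhds x)" using U(1,2) by (rule eventually_nhds_in_open)
  then have "eventually (\<lambda>y. g y = f y) (at x within S)"
    unfolding eventually_at_filter by eventually_elim (use U(4) in auto)
  moreover have "g x = f x" using U x by simp
  ultimately show "continuous (at x within S) f"
    by (simp add: continuous_within Lim_transform_eventually)
qed

text \<open>Smoothness up to the boundary is preserved because local extensions compose. This is what
  allows the free surface to be handled on closed half planes.\<close>

lemma smooth_on_compose:
  fixes f :: "'a::euclidean_space \<Rightarrow> 'b::euclidean_space" and g :: "'b \<Rightarrow> 'c::real_normed_vector"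
  assumes g: "smooth_on T g" and f: "smooth_on S f" and "\<And>x. x \<in> S \<Longrightarrow> f x \<in> T"
  shows "smooth_on S (\<lambda>x. g (f x))"
proof (rule smooth_onI)
  fix x assume x: "x \<in> S"
  from f x obtain U f1 where U: "open U" "x \<in> U" "\<forall>n. Ck_on n U f1"
      "\<forall>y\<in>U \<inter> S. f1 y = f y"
    by (rule smooth_onE)
  from g assms(3)[OF x] obtain V g1 where V: "open V" "f x \<in> V" "\<forall>n. Ck_on n V g1"
      "\<forall>y\<in>V \<inter> T. g1 y = g y"
    by (rule smooth_onE)
  let ?U = "U \<inter> f1 -` V"
  have "continuous_on U f1" using U(3)[rule_format, of 0] by simp
  then have op: "open ?U" using U(1) V(1) by (simp add: continuous_open_preimage)
  have ck: "Ck_on n ?U (\<lambda>x. g1 (f1 x))" for n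
    by (rule Ck_on_compose[OF op Ck_on_subset[OF U(3)[rule_format]] V(3)[rule_format]]) auto
  have "x \<in> ?U" using U(2,4) V(2) x by simp
  moreover have "\<forall>y\<in>?U \<inter> S. g1 (f1 y) = g (f y)" using U(4) V(4) assms(3) by auto
  ultimately show "\<exists>U h. open U \<and> x \<in> U \<and> (\<forall>n. Ck_on n U h) \<and> (\<forall>y\<in>U \<inter> S. h y = g (f y))"
    using op ck by (intro exI[of _ ?U] exI[of _ "\<lambda>x. g1 (f1 x)"]) simp
qed

named_theorems smooth_intros

lemma smooth_on_bounded_linear: "bounded_linear f \<Longrightarrow> smooth_on S f"
  by (intro smooth_on_UNIVI Ck_on_bounded_linear) auto

lemma smooth_on_const [smooth_intros]: "smooth_on S (\<lambda>x. c)"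
  by (intro smooth_on_UNIVI Ck_on_const)

lemma smooth_on_ident [smooth_intros]: "smooth_on S (\<lambda>x. x)"
  by (intro smooth_on_bounded_linear bounded_linear_ident)

lemma smooth_on_Pair [smooth_intros]:
  assumes "smooth_on S f" "smooth_on S g"
  shows "smooth_on S (\<lambda>x. (f x, g x))"
proof (rule smooth_onI)
  fix x assume x: "x \<in> S"
  from assms(1) x obtain U f1 where U: "open U" "x \<in> U" "\<forall>n. Ck_on n U f1"
      "\<forall>y\<in>U \<inter> S. f1 y = f y"
    by (rule smooth_onE)
  from assms(2) x obtain V g1 where V: "open V" "x \<in> V" "\<forall>n. Ck_on n V g1"
      "\<forall>y\<in>V \<inter> S. g1 y = g y"
    by (rule smooth_onE)
  have "Ck_on n (U \<inter> V) (\<lambda>x. (f1 x, g1 x))" for n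
    by (intro Ck_on_Pair open_Int U(1) V(1) Ck_on_subset[OF U(3)[rule_format]] Ck_on_subset[OF V(3)[rule_format]]) auto
  then show "\<exists>U h. open U \<and> x \<in> U \<and> (\<forall>n. Ck_on n U h) \<and> (\<forall>y\<in>U \<inter> S. h y = (f y, g y))"
    using U(1,2,4) V(1,2,4)
    by (intro exI[of _ "U \<inter> V"] exI[of _ "\<lambda>x. (f1 x, g1 x)"]) (simp add: open_Int)
qed

lemma smooth_on_fst [smooth_intros]:
  fixes f :: "'a::euclidean_space \<Rightarrow> 'b::euclidean_space \<times> 'c::euclidean_space"
  shows "smooth_on S f \<Longrightarrow> smooth_on S (\<lambda>x. fst (f x))"
  by (rule smooth_on_compose[of UNIV fst]) (auto intro: smooth_on_bounded_linear bounded_linear_fst)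

lemma smooth_on_snd [smooth_intros]:
  fixes f :: "'a::euclidean_space \<Rightarrow> 'b::euclidean_space \<times> 'c::euclidean_space"
  shows "smooth_on S f \<Longrightarrow> smooth_on S (\<lambda>x. snd (f x))"
  by (rule smooth_on_compose[of UNIV snd]) (auto intro: smooth_on_bounded_linear bounded_linear_snd)

lemma smooth_on_add [smooth_intros]:
  fixes f g :: "'a::euclidean_space \<Rightarrow> 'b::euclidean_space"
  assumes "smooth_on S f" "smooth_on S g"
  shows "smooth_on S (\<lambda>x. f x + g x)"
  using smooth_on_compose[where T = UNIV, OF _ smooth_on_Pair[OF assms], of "\<lambda>p. fst p + snd p"]
  by (simp add: smooth_on_bounded_linear bounded_linear_add bounded_linear_fst bounded_linear_snd)

lemma smooth_on_mult [smooth_intros]: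
  fixes f g :: "'a::euclidean_space \<Rightarrow> real"
  assumes "smooth_on S f" "smooth_on S g"
  shows "smooth_on S (\<lambda>x. f x * g x)"
proof -
  have "smooth_on UNIV (\<lambda>p::real \<times> real. fst p * snd p)"
    by (intro smooth_on_UNIVI Ck_on_bilinear[OF bounded_bilinear_mult] Ck_on_bounded_linear
        bounded_linear_fst bounded_linear_snd) auto
  then show ?thesis
    using smooth_on_compose[OF _ smooth_on_Pair[OF assms]] by fastforce
qed

lemma smooth_on_minus [smooth_intros]:
  fixes f :: "'a::euclidean_space \<Rightarrow> real"
  shows "smooth_on S f \<Longrightarrow> smooth_on S (\<lambda>x. - f x)"
  using smooth_on_mult[OF smooth_on_const[of S "-1"], of f] by simp

lemma smooth_on_diff [smooth_intros]:
  fixes f g :: "'a::euclidean_space \<Rightarrow> real"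
  shows "smooth_on S f \<Longrightarrow> smooth_on S g \<Longrightarrow> smooth_on S (\<lambda>x. f x - g x)"
  using smooth_on_add[OF _ smooth_on_minus, of S f g] by simp

lemma smooth_on_power [smooth_intros]:
  fixes f :: "'a::euclidean_space \<Rightarrow> real"
  shows "smooth_on S f \<Longrightarrow> smooth_on S (\<lambda>x. f x ^ n)"
  by (induction n) (auto intro!: smooth_intros)

text \<open>An entire power series can be differentiated termwise, and its derivative is again an entire
  power series.\<close>

lemma smooth_on_entire_series:
  fixes a :: "nat \<Rightarrow> real"
  assumes "\<And>x. summable (\<lambda>n. a n * x ^ n)"
  shows "smooth_on S (\<lambda>x. \<Sum>n. a n * x ^ n)"
proof (rule smooth_on_UNIVI)
  fix n show "Ck_on n UNIV (\<lambda>x. \<Sum>n. a n * x ^ n)"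
    using assms
  proof (induction n arbitrary: a)
    case 0
    then show ?case
      by (auto intro!: DERIV_continuous_on
          DERIV_subset[OF termdiffs_strong_converges_everywhere])
  next
    case (Suc n)
    show ?case
    proof (rule Ck_on_SucI)
      show "((\<lambda>x. \<Sum>n. a n * x ^ n) has_derivative (\<lambda>v. (\<Sum>n. diffs a n * x ^ n) * v)) (at x)" for x
        using termdiffs_strong_converges_everywhere[OF Suc.prems, of x]
        by (simp add: has_field_derivative_def)
      show "Ck_on n UNIV (\<lambda>x. (\<Sum>n. diffs a n * x ^ n) * v)" for v
        by (intro Ck_on_bilinear[OF bounded_bilinear_mult] Suc.IH Ck_on_const
            termdiff_converges_all Suc.prems) auto
    qed auto
  qed
qed

lemma smooth_on_exp [smooth_intros]:
  fixes f :: "'a::euclidean_space \<Rightarrow> real"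
  assumes "smooth_on S f" shows "smooth_on S (\<lambda>x. exp (f x))"
proof -
  have "smooth_on UNIV (\<lambda>x::real. \<Sum>n. inverse (fact n) * x ^ n)"
    by (rule smooth_on_entire_series) (simp add: summable_exp)
  then have "smooth_on UNIV (exp :: real \<Rightarrow> real)"
    by (rule smooth_on_cong) (simp add: exp_def divide_inverse mult.commute)
  then show ?thesis by (rule smooth_on_compose[OF _ assms]) auto
qed

lemma smooth_on_sin [smooth_intros]:
  fixes f :: "'a::euclidean_space \<Rightarrow> real"
  assumes "smooth_on S f" shows "smooth_on S (\<lambda>x. sin (f x))"
proof -
  have "smooth_on UNIV (\<lambda>x::real. \<Sum>n. sin_coeff n * x ^ n)"
    by (rule smooth_on_entire_series) (use sin_converges[where 'a = real] in \<open>auto simp: sums_iff\<close>)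
  then have "smooth_on UNIV (sin :: real \<Rightarrow> real)"
    by (rule smooth_on_cong) (simp add: sin_def)
  then show ?thesis by (rule smooth_on_compose[OF _ assms]) auto
qed

lemma smooth_on_cos [smooth_intros]:
  fixes f :: "'a::euclidean_space \<Rightarrow> real"
  assumes "smooth_on S f" shows "smooth_on S (\<lambda>x. cos (f x))"
proof -
  have "smooth_on UNIV (\<lambda>x::real. \<Sum>n. cos_coeff n * x ^ n)"
    by (rule smooth_on_entire_series) (use cos_converges[where 'a = real] in \<open>auto simp: sums_iff\<close>)
  then have "smooth_on UNIV (cos :: real \<Rightarrow> real)"
    by (rule smooth_on_cong) (simp add: cos_def)
  then show ?thesis by (rule smooth_on_compose[OF _ assms]) auto
qed

lemma smooth_on_inverse [smooth_intros]:
  fixes f :: "'a::euclidean_space \<Rightarrow> real"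
  assumes "smooth_on S f" "\<And>x. x \<in> S \<Longrightarrow> f x \<noteq> 0"
  shows "smooth_on S (\<lambda>x. inverse (f x))"
proof -
  have op: "open (- {0::real})" by auto
  have "Ck_on n (- {0::real}) inverse" for n
  proof (induction n)
    case 0
    show ?case by (auto intro!: continuous_intros)
  next
    case (Suc n)
    show ?case
    proof (rule Ck_on_SucI[OF op])
      show "(inverse has_derivative (\<lambda>v. - (inverse x * v * inverse x))) (at x)"
        if "x \<in> - {0::real}" for x
        using that by (auto intro!: has_derivative_inverse')
      have "Ck_on n (- {0::real}) (\<lambda>x. inverse x * inverse x * (- v))" for v
        by (intro Ck_on_bilinear[OF bounded_bilinear_mult] Suc Ck_on_const op)
      then show "Ck_on n (- {0::real}) (\<lambda>x. - (inverse x * v * inverse x))" for v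
        by (simp add: mult_ac)
    qed
  qed
  then have "smooth_on (- {0::real}) inverse" using op by (simp add: smooth_on_open_iff)
  then show ?thesis by (rule smooth_on_compose[OF _ assms(1)]) (use assms(2) in auto)
qed

lemma smooth_on_divide [smooth_intros]:
  fixes f g :: "'a::euclidean_space \<Rightarrow> real"
  assumes "smooth_on S f" "smooth_on S g" "\<And>x. x \<in> S \<Longrightarrow> g x \<noteq> 0"
  shows "smooth_on S (\<lambda>x. f x / g x)"
  unfolding divide_inverse by (intro smooth_intros assms)

lemma smooth_on_sqrt [smooth_intros]:
  fixes f :: "'a::euclidean_space \<Rightarrow> real"
  assumes "smooth_on S f" "\<And>x. x \<in> S \<Longrightarrow> f x > 0"
  shows "smooth_on S (\<lambda>x. sqrt (f x))"
proof -
  have op: "open {0::real<..}" by auto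
  have "Ck_on n {0::real<..} sqrt" for n
  proof (induction n)
    case 0
    show ?case by (auto intro!: continuous_intros)
  next
    case (Suc n)
    have inv: "Ck_on n (- {0::real}) inverse"
      using smooth_on_inverse[OF smooth_on_ident, of "- {0::real}"]
        smooth_on_open_iff[of "- {0::real}" inverse] by auto
    show ?case
    proof (rule Ck_on_SucI[OF op])
      show "(sqrt has_derivative (\<lambda>v. inverse (sqrt x) * (1 / 2) * v)) (at x)"
        if "x \<in> {0::real<..}" for x
        using DERIV_real_sqrt[of x] that
        by (auto simp: has_field_derivative_def elim!: has_derivative_eq_rhs)
      show "Ck_on n {0::real<..} (\<lambda>x. inverse (sqrt x) * (1 / 2) * v)" for v
        by (intro Ck_on_bilinear[OF bounded_bilinear_mult] Ck_on_const op
            Ck_on_compose[OF op Suc inv]) auto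
    qed
  qed
  then have "smooth_on {0::real<..} sqrt" using op by (simp add: smooth_on_open_iff)
  then show ?thesis by (rule smooth_on_compose[OF _ assms(1)]) (use assms(2) in auto)
qed

lemma smooth_on_frechet_derivative:
  "open U \<Longrightarrow> smooth_on U f \<Longrightarrow> smooth_on U (\<lambda>x. frechet_derivative f (at x) v)"
  by (metis Ck_on.simps(2) smooth_on_open_iff)

text \<open>Invariance of domain gives an open image and a continuous
  inverse \<open>g\<close>, which is then differentiable with derivative \<open>(f' (g y))\<^sup>-\<^sup>1\<close>. Its regularity is
  bootstrapped from this formula: if \<open>g\<close> is of class \<open>n\<close>, then so is the right hand side, so \<open>g\<close> is
  of class \<open>n + 1\<close>.\<close>

lemma diffeomorphism_onI:
  fixes f :: "'a::euclidean_space \<Rightarrow> 'a"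
  assumes U: "open U" and f: "smooth_on U f" and inj: "inj_on f U"
    and f': "\<And>x. x \<in> U \<Longrightarrow> (f has_derivative f' x) (at x)"
    and right_inverse: "\<And>x v. x \<in> U \<Longrightarrow> f' x (g' x v) = v"
    and g': "\<And>v. smooth_on U (\<lambda>x. g' x v)"
  shows "diffeomorphism_on U (f ` U) f"
proof -
  let ?W = "f ` U" and ?g = "inv_into U f"
  have cont: "continuous_on U f" using f by (rule smooth_on_imp_continuous_on)
  have W: "open ?W" using cont U inj by (rule invariance_of_domain)
  have gW: "?g ` ?W \<subseteq> U" using inj by auto
  have der: "(?g has_derivative g' (?g y)) (at y)" if "y \<in> ?W" for y
  proof -
    obtain x where x: "x \<in> U" "y = f x" using \<open>y \<in> ?W\<close> by blast
    have "(?g has_derivative g' x) (at (f x))"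
      by (rule has_derivative_inverse_strong[OF U x(1) cont])
        (use inj f'[OF x(1)] right_inverse[OF x(1)] in auto)
    then show ?thesis using x inj by simp
  qed
  have "Ck_on n ?W ?g" for n
  proof (induction n)
    case 0
    have "isCont ?g y" if "y \<in> ?W" for y
      using der[OF that] by (rule has_derivative_continuous)
    then show ?case by (simp add: continuous_at_imp_continuous_on)
  next
    case (Suc n)
    show ?case
    proof (rule Ck_on_SucI[OF W der])
      show "Ck_on n ?W (\<lambda>y. g' (?g y) v)" for v
        using g' U by (intro Ck_on_compose[OF W Suc _ gW]) (simp add: smooth_on_open_iff)
    qed
  qed
  then show ?thesis
    unfolding diffeomorphism_on_def
    using U W f inj by (simp add: smooth_on_open_iff inj_on_imp_bij_betw)
qed

section \<open>Kepler's equation\<close>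

lemma abs_sin_less_abs:
  fixes x :: real
  assumes "x \<noteq> 0" shows "\<bar>sin x\<bar> < \<bar>x\<bar>"
proof -
  have pos: "\<bar>sin y\<bar> < y" if "y > 0" for y :: real
  proof (cases "y > 1")
    case True
    then show ?thesis using abs_sin_le_one[of y] by linarith
  next
    case False
    obtain z where z: "0 < z" "z < y" "sin y - sin 0 = (y - 0) * cos z"
      using MVT2[OF \<open>y > 0\<close> DERIV_sin] by blast
    have "cos z < cos 0" using z False pi_gt3 by (intro cos_monotone_0_pi) auto
    then have "sin y < y" using z that by simp
    moreover have "sin y > 0" using that False pi_gt3 by (intro sin_gt_zero) auto
    ultimately show ?thesis by simp
  qed
  show ?thesis using pos[of x] pos[of "- x"] assms by (cases "x > 0") auto
qed

lemma abs_sin_diff_less: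
  fixes x y :: real
  assumes "x \<noteq> y" shows "\<bar>sin x - sin y\<bar> < \<bar>x - y\<bar>"
proof -
  have "\<bar>sin x - sin y\<bar> = 2 * \<bar>sin ((x - y) / 2)\<bar> * \<bar>cos ((x + y) / 2)\<bar>"
    by (simp add: sin_diff_sin abs_mult)
  also have "\<dots> \<le> 2 * \<bar>sin ((x - y) / 2)\<bar>"
    by (simp add: mult_left_le)
  also have "\<dots> < 2 * \<bar>(x - y) / 2\<bar>" using assms abs_sin_less_abs[of "(x - y) / 2"] by simp
  finally show ?thesis by simp
qed

lemma kepler_equation_inj:
  fixes e :: real
  assumes "\<bar>e\<bar> \<le> 1" "E - e * sin E = E' - e * sin E'"
  shows "E = E'"
proof (rule ccontr)
  assume "E \<noteq> E'"
  have "\<bar>E - E'\<bar> = \<bar>e\<bar> * \<bar>sin E - sin E'\<bar>"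
    using assms(2) by (simp add: abs_mult[symmetric] algebra_simps)
  also have "\<dots> \<le> \<bar>sin E - sin E'\<bar>" using assms(1) by (simp add: mult_left_le_one_le)
  also have "\<dots> < \<bar>E - E'\<bar>" using \<open>E \<noteq> E'\<close> by (rule abs_sin_diff_less)
  finally show False by simp
qed

lemma kepler_equation_solvable:
  fixes e M :: real
  assumes "\<bar>e\<bar> \<le> 1" shows "\<exists>E. E - e * sin E = M"
proof -
  have bound: "\<bar>e * sin x\<bar> \<le> 1" for x
    using assms by (simp add: abs_mult mult_le_one)
  have "\<exists>E\<ge>M - 1. E \<le> M + 1 \<and> E - e * sin E = M"
    by (rule IVT') (use bound[of "M - 1"] bound[of "M + 1"] in \<open>auto intro!: continuous_intros\<close>)
  then show ?thesis by blast
qed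

text \<open>The eccentric anomaly as a function of the mean anomaly \<open>M\<close> and the eccentricity \<open>e\<close>.\<close>

definition kepler :: "real \<Rightarrow> real \<Rightarrow> real" where
  "kepler M e = (THE E. E - e * sin E = M)"

lemma kepler_unique: "\<bar>e\<bar> \<le> 1 \<Longrightarrow> E - e * sin E = M \<Longrightarrow> kepler M e = E"
  unfolding kepler_def by (rule the_equality) (auto intro: kepler_equation_inj)

lemma kepler_eq: "\<bar>e\<bar> \<le> 1 \<Longrightarrow> kepler M e - e * sin (kepler M e) = M"
  using kepler_equation_solvable[of e M] kepler_unique by metis

lemma kepler_2pi: "\<bar>e\<bar> \<le> 1 \<Longrightarrow> kepler (of_int n * (2 * pi)) e = of_int n * (2 * pi)"
  by (rule kepler_unique) (auto simp: mult_ac sin_int_2pin[of n, simplified mult_ac])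

text \<open>For \<open>e = 1\<close> the derivative of \<open>E - e sin E\<close> vanishes at the multiples of \<open>2 \<pi>\<close>, so continuity there
  is topological: \<open>(M, e) \<mapsto> (E, e)\<close> inverts a continuous injection of the plane.\<close>

lemma continuous_on_kepler:
  "continuous_on (UNIV \<times> {0..1}) (\<lambda>p. kepler (fst p) (snd p))"
proof -
  \<comment> \<open>Freezing the eccentricity outside \<open>[0, 1]\<close> makes the equation uniquely solvable on an open set,
     as invariance of domain requires, also around the boundary value \<open>e = 1\<close>.\<close>
  define clamp where "clamp e = max 0 (min 1 e)" for e :: real
  have clamp: "\<bar>clamp e\<bar> \<le> 1" for e by (auto simp: clamp_def)
  define F where "F p = (fst p - clamp (snd p) * sin (fst p), snd p)" for p :: "real \<times> real"
  define G where "G p = (kepler (fst p) (clamp (snd p)), snd p)" for p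
  have GF: "G (F p) = p" for p
    using kepler_unique[OF clamp] by (auto simp: F_def G_def prod_eq_iff)
  have "F (G p) = p" for p
    using kepler_eq[OF clamp] by (auto simp: F_def G_def prod_eq_iff)
  then have "range F = UNIV" by (metis surjI)
  moreover have "continuous_on (range F) G"
    by (rule continuous_on_inverse_open)
      (use GF in \<open>auto simp: F_def clamp_def intro!: continuous_intros\<close>)
  ultimately have "continuous_on (UNIV \<times> {0..1}) (\<lambda>p. fst (G p))"
    by (metis continuous_on_fst continuous_on_subset subset_UNIV)
  then show ?thesis
    by (rule continuous_on_eq) (auto simp: G_def clamp_def)
qed

text \<open>Away from the points with \<open>e = 1\<close> and \<open>M \<in> 2 \<pi> \<int>\<close> the derivative \<open>1 - e cos E\<close> is positive, also on a
  full neighbourhood that contains eccentricities \<open>e > 1\<close>. The local inverse on that neighbourhood is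
  the smooth extension across \<open>e = 1\<close>.\<close>

lemma smooth_on_kepler:
  "smooth_on {p. 0 \<le> snd p \<and> snd p \<le> 1 \<and> (snd p = 1 \<longrightarrow> fst p \<notin> range (\<lambda>n::int. of_int n * (2 * pi)))}
     (\<lambda>p. kepler (fst p) (snd p))"
  (is "smooth_on ?S _")
proof (rule smooth_onI)
  fix p assume p: "p \<in> ?S"
  obtain M e where Me: "p = (M, e)" by fastforce
  define E where "E = kepler M e"
  have e: "0 \<le> e" "e \<le> 1" using p Me by auto
  then have E: "E - e * sin E = M" unfolding E_def by (intro kepler_eq) auto
  have "e * cos E < 1"
  proof (cases "e = 1")
    case False
    have "e * cos E \<le> e" using e by (simp add: mult_left_le)
    then show ?thesis using False e by linarith
  next
    case True
    have "cos E \<noteq> 1"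
    proof
      assume "cos E = 1"
      then obtain n :: int where "E = of_int n * 2 * pi" by (auto simp: cos_one_2pi_int)
      moreover from this have "sin E = 0" by (metis \<open>cos E = 1\<close> cos_one_sin_zero)
      ultimately have "M = of_int n * (2 * pi)" using E by simp
      then show False using p Me True by auto
    qed
    then have "cos E < 1" using cos_le_one[of E] by linarith
    then show ?thesis using True by simp
  qed
  moreover have "open {u::real \<times> real. snd u * cos (fst u) < 1}"
    by (intro open_Collect_less continuous_intros)
  ultimately obtain A B where AB: "open A" "open B" "(E, e) \<in> A \<times> B"
      "A \<times> B \<subseteq> {u::real \<times> real. snd u * cos (fst u) < 1}"
    by (elim open_prod_elim[of _ "(E, e)"]) auto
  from AB obtain \<delta> where \<delta>: "\<delta> > 0" "ball E \<delta> \<subseteq> A" by (auto elim: openE)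
  \<comment> \<open>A box, so that two of its points with equal \<open>e\<close> are joined by a segment of constant \<open>e\<close>.\<close>
  define U where "U = ball E \<delta> \<times> B"
  have U: "open U" "(E, e) \<in> U" using AB \<delta> by (auto simp: U_def open_Times)
  have pos: "1 - snd u * cos (fst u) > 0" if "u \<in> U" for u
  proof -
    have "u \<in> A \<times> B" using that \<delta>(2) unfolding U_def by auto
    then show ?thesis using AB(4) by auto
  qed
  define F where "F u = (fst u - snd u * sin (fst u), snd u)" for u :: "real \<times> real"
  have less: "x - s * sin x < y - s * sin y" if "x < y" "(x, s) \<in> U" "(y, s) \<in> U" for x y s
  proof (rule DERIV_pos_imp_increasing[OF \<open>x < y\<close>])
    fix z assume "x \<le> z" "z \<le> y"
    then have "(z, s) \<in> U" using that by (auto simp: U_def dist_real_def)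
    moreover have "((\<lambda>x. x - s * sin x) has_real_derivative 1 - s * cos z) (at z)"
      by (auto intro!: derivative_eq_intros)
    ultimately show "\<exists>d. ((\<lambda>x. x - s * sin x) has_real_derivative d) (at z) \<and> d > 0"
      using pos[of "(z, s)"] by auto
  qed
  have inj: "inj_on F U"
  proof (rule inj_onI)
    fix u v assume "u \<in> U" "v \<in> U" "F u = F v"
    then show "u = v"
      using less[of "fst u" "fst v" "snd u"] less[of "fst v" "fst u" "snd u"]
      by (cases u; cases v; cases "fst u" "fst v" rule: linorder_cases) (auto simp: F_def)
  qed
  have diffeo: "diffeomorphism_on U (F ` U) F"
  proof (rule diffeomorphism_onI[OF U(1) _ inj])
    show "smooth_on U F" unfolding F_def by (intro smooth_intros)
    show "(F has_derivative (\<lambda>v. (fst v - (snd u * (cos (fst u) * fst v) + snd v * sin (fst u)), snd v))) (at u)"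
      if "u \<in> U" for u
      unfolding F_def by (auto intro!: derivative_eq_intros)
    show "smooth_on U (\<lambda>u. ((fst v + snd v * sin (fst u)) / (1 - snd u * cos (fst u)), snd v))" for v
      using pos by (intro smooth_intros) force
    show "(fst ((fst v + snd v * sin (fst u)) / (1 - snd u * cos (fst u)), snd v)
        - (snd u * (cos (fst u) * fst ((fst v + snd v * sin (fst u)) / (1 - snd u * cos (fst u)), snd v))
           + snd ((fst v + snd v * sin (fst u)) / (1 - snd u * cos (fst u)), snd v) * sin (fst u)),
        snd ((fst v + snd v * sin (fst u)) / (1 - snd u * cos (fst u)), snd v)) = v"
      if "u \<in> U" for u v
    proof -
      define m where "m = fst v + snd v * sin (fst u)"
      have factor: "q - s * (c * q) = q * (1 - s * c)" for q s c :: real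
        by (simp add: algebra_simps)
      have "m / (1 - snd u * cos (fst u)) - snd u * (cos (fst u) * (m / (1 - snd u * cos (fst u))))
          = m / (1 - snd u * cos (fst u)) * (1 - snd u * cos (fst u))"
        by (rule factor)
      also have "\<dots> = m" using pos[OF that] by simp
      finally show ?thesis by (simp add: prod_eq_iff m_def[symmetric]) (simp add: m_def)
    qed
  qed
  then have FU: "open (F ` U)" and "smooth_on (F ` U) (inv_into U F)"
    by (auto simp: diffeomorphism_on_def)
  then have "smooth_on (F ` U) (\<lambda>w. fst (inv_into U F w))" by (intro smooth_intros)
  then have "\<forall>n. Ck_on n (F ` U) (\<lambda>w. fst (inv_into U F w))" using FU by (simp add: smooth_on_open_iff)
  moreover have "F (E, e) \<in> F ` U" using U(2) by (rule imageI)
  then have "p \<in> F ` U" using E Me by (simp add: F_def)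
  moreover have "\<forall>w\<in>F ` U \<inter> ?S. fst (inv_into U F w) = kepler (fst w) (snd w)"
  proof
    fix w assume w: "w \<in> F ` U \<inter> ?S"
    then obtain u where u: "u \<in> U" "w = F u" by blast
    then have "kepler (fst w) (snd w) = fst u"
      using w by (intro kepler_unique) (auto simp: F_def)
    then show "fst (inv_into U F w) = kepler (fst w) (snd w)" using inj u by simp
  qed
  ultimately show "\<exists>U g. open U \<and> p \<in> U \<and> (\<forall>n. Ck_on n U g)
      \<and> (\<forall>w\<in>U \<inter> ?S. g w = kepler (fst w) (snd w))"
    using FU by blast
qed

lemma kepler_strict_mono:
  assumes "M < M'" "\<bar>e\<bar> \<le> 1" shows "kepler M e < kepler M' e"
proof (rule ccontr)
  let ?E = "kepler M e" and ?E' = "kepler M' e"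
  assume "\<not> ?E < ?E'"
  then have "?E - ?E' \<ge> 0" by simp
  moreover have "\<bar>e * (sin ?E - sin ?E')\<bar> \<le> \<bar>?E - ?E'\<bar>"
  proof -
    have "\<bar>e\<bar> * \<bar>sin ?E - sin ?E'\<bar> \<le> \<bar>sin ?E - sin ?E'\<bar>"
      using assms(2) by (simp add: mult_left_le_one_le)
    also have "\<dots> \<le> \<bar>?E - ?E'\<bar>" using abs_sin_diff_less[of ?E ?E'] by (cases "?E = ?E'") auto
    finally show ?thesis by (simp add: abs_mult)
  qed
  ultimately have "?E - e * sin ?E \<ge> ?E' - e * sin ?E'" by (simp add: algebra_simps)
  then show False using kepler_eq[OF assms(2)] assms(1) by simp
qed

lemma isCont_kepler_one: "isCont (\<lambda>M. kepler M 1) M"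
proof -
  have "continuous_on UNIV (\<lambda>M. kepler (fst (M, 1 :: real)) (snd (M, 1 :: real)))"
    by (rule continuous_on_compose2[OF continuous_on_kepler]) (auto intro!: continuous_intros)
  then show ?thesis by (simp add: continuous_on_eq_continuous_at)
qed

section \<open>The cusps of the cycloid\<close>

text \<open>The slope of the cycloid at eccentric anomaly \<open>\<theta>\<close> is \<open>- sin \<theta> / (1 - cos \<theta>) = - cot (\<theta> / 2)\<close>. It has
  poles exactly at the crests \<open>\<theta> \<in> 2 \<pi> \<int>\<close>, where it jumps from \<open>+\<infinity>\<close> to \<open>-\<infinity>\<close>.\<close>

lemma upward_cusp_cycloid:
  fixes k d :: real and n :: int
  assumes k: "k > 0"
  shows "upward_cusp (\<lambda>x. (1 / k) * cos (kepler (k * (x - d)) 1)) (d + of_int n * (2 * pi / k))"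
    (is "upward_cusp ?h ?a")
proof -
  let ?K = "\<lambda>x. kepler (k * (x - d)) 1" and ?\<theta> = "of_int n * (2 * pi)"
  let ?slope = "\<lambda>\<theta>::real. - sin \<theta> / (1 - cos \<theta>)"
  have cont: "isCont ?K x" for x
    by (rule isCont_o2[OF _ isCont_kepler_one]) (intro continuous_intros)
  have Ka: "?K ?a = ?\<theta>" using k kepler_2pi[of 1 n] by simp
  have Kless: "?K x < ?K y" if "x < y" for x y
    using k that by (intro kepler_strict_mono) auto
  \<comment> \<open>One period on either side contains no other crest.\<close>
  have near: "\<forall>\<^sub>F x in at ?a. x \<in> {?a - 2 * pi / k<..<?a + 2 * pi / k} - {?a}"
    using k by (intro eventually_at_in_open) auto
  have der: "(?h has_real_derivative ?slope (?K x)) (at x)"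
    if x: "x \<in> {?a - 2 * pi / k<..<?a + 2 * pi / k} - {?a}" for x
  proof -
    have "cos (?K x) \<noteq> 1"
    proof
      assume "cos (?K x) = 1"
      then obtain m :: int where m: "?K x = of_int m * (2 * pi)" by (auto simp: cos_one_2pi_int)
      moreover have "sin (?K x) = 0" using \<open>cos (?K x) = 1\<close> by (metis cos_one_sin_zero)
      ultimately have "k * (x - d) = of_int m * (2 * pi)" using kepler_eq[of 1 "k * (x - d)"] by simp
      then have xm: "x = d + of_int m * (2 * pi / k)" using k by (simp add: field_simps)
      define period where "period = 2 * pi / k"
      have "period > 0" using k by (simp add: period_def)
      have "of_int (m - n) * period < 1 * period" "of_int (n - m) * period < 1 * period"
        using x unfolding xm period_def[symmetric] by (auto simp: algebra_simps)
      then have "of_int (m - n) < (1 :: real)" "of_int (n - m) < (1 :: real)"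
        using \<open>period > 0\<close> by (simp_all only: mult_less_cancel_right_pos)
      then have "m = n" by simp
      then show False using x xm by simp
    qed
    then have D: "1 - cos (?K x) \<noteq> 0" by simp
    have inner: "(?K has_real_derivative inverse ((1 - cos (?K x)) / k)) (at x)"
    proof (rule DERIV_inverse_function[where f = "\<lambda>E. d + (E - sin E) / k" and a = "x - 1" and b = "x + 1"])
      show "((\<lambda>E. d + (E - sin E) / k) has_real_derivative (1 - cos (?K x)) / k) (at (?K x))"
        using k by (auto intro!: derivative_eq_intros)
      show "d + (?K y - sin (?K y)) / k = y" for y
        using kepler_eq[of 1 "k * (y - d)"] k by (simp add: field_simps)
    qed (use D k cont in auto)
    have "(?h has_real_derivative (1 / k) * (- sin (?K x) * inverse ((1 - cos (?K x)) / k))) (at x)"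
      by (intro DERIV_cmult DERIV_fun_cos inner)
    then show ?thesis using k by (simp add: field_simps)
  qed
  have ev: "\<forall>\<^sub>F x in at ?a. ?slope (?K x) = deriv ?h x"
    using near by eventually_elim (rule DERIV_imp_deriv[OF der, symmetric])
  have h_cont: "isCont ?h ?a" by (intro continuous_intros cont)
  have h_diff: "\<forall>\<^sub>F x in at ?a. ?h differentiable (at x)"
    using near by eventually_elim (use der in \<open>auto simp: real_differentiable_def\<close>)
  have lim: "((\<lambda>x. ?K x - ?\<theta>) \<longlongrightarrow> 0) (at ?a)"
    using cont[of ?a] unfolding isCont_def Ka by (rule LIM_zero)
  have "sin ?\<theta> = 0" "cos ?\<theta> = 1"
    using sin_int_2pin[of n] cos_int_2pin[of n] by (simp_all add: mult_ac)
  then have shift: "?slope (?K x) = ?slope (?K x - ?\<theta>)" for x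
    by (simp only: sin_diff cos_diff) simp
  have left: "filterlim (deriv ?h) at_top (at_left ?a)"
  proof -
    have "filterlim (\<lambda>x. ?K x - ?\<theta>) (at_left 0) (at_left ?a)"
      unfolding filterlim_at
    proof
      show "((\<lambda>x. ?K x - ?\<theta>) \<longlongrightarrow> 0) (at_left ?a)"
        using at_le[OF subset_UNIV] lim by (rule tendsto_mono)
      show "\<forall>\<^sub>F x in at_left ?a. ?K x - ?\<theta> \<in> {..<0} \<and> ?K x - ?\<theta> \<noteq> 0"
        unfolding eventually_at_filter
      proof (intro always_eventually allI impI)
        fix x assume "x \<in> {..<?a}"
        then show "?K x - ?\<theta> \<in> {..<0} \<and> ?K x - ?\<theta> \<noteq> 0"
          using Kless[of x ?a] unfolding Ka by simp
      qed
    qed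
    moreover have "filterlim ?slope at_top (at_left 0)" by real_asymp
    ultimately have slope: "filterlim (\<lambda>x. ?slope (?K x)) at_top (at_left ?a)"
      unfolding shift by (rule filterlim_compose[rotated])
    have eq: "\<forall>\<^sub>F x in at_left ?a. ?slope (?K x) = deriv ?h x"
      using at_le[OF subset_UNIV] ev by (rule filter_leD)
    show ?thesis using slope by (rule iffD1[OF filterlim_cong[OF refl refl eq]])
  qed
  have right: "filterlim (deriv ?h) at_bot (at_right ?a)"
  proof -
    have "filterlim (\<lambda>x. ?K x - ?\<theta>) (at_right 0) (at_right ?a)"
      unfolding filterlim_at
    proof
      show "((\<lambda>x. ?K x - ?\<theta>) \<longlongrightarrow> 0) (at_right ?a)"
        using at_le[OF subset_UNIV] lim by (rule tendsto_mono)
      show "\<forall>\<^sub>F x in at_right ?a. ?K x - ?\<theta> \<in> {0<..} \<and> ?K x - ?\<theta> \<noteq> 0"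
        unfolding eventually_at_filter
      proof (intro always_eventually allI impI)
        fix x assume "x \<in> {?a<..}"
        then show "?K x - ?\<theta> \<in> {0<..} \<and> ?K x - ?\<theta> \<noteq> 0"
          using Kless[of ?a x] unfolding Ka by simp
      qed
    qed
    moreover have "filterlim ?slope at_bot (at_right 0)" by real_asymp
    ultimately have slope: "filterlim (\<lambda>x. ?slope (?K x)) at_bot (at_right ?a)"
      unfolding shift by (rule filterlim_compose[rotated])
    have eq: "\<forall>\<^sub>F x in at_right ?a. ?slope (?K x) = deriv ?h x"
      using at_le[OF subset_UNIV] ev by (rule filter_leD)
    show ?thesis using slope by (rule iffD1[OF filterlim_cong[OF refl refl eq]])
  qed
  show ?thesis
    unfolding upward_cusp_def using h_cont h_diff left right by (intro conjI)
qed

section \<open>Trochoidal curves\<close>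

lemma exp_diff_less:
  fixes a b :: real
  assumes "a < b" "b \<le> 0" shows "exp b - exp a < b - a"
proof -
  have "exp b - exp a = exp b * (1 - exp (a - b))" by (simp add: exp_diff algebra_simps)
  also have "\<dots> \<le> 1 - exp (a - b)" using assms by (simp add: mult_left_le_one_le)
  also have "\<dots> < b - a" using exp_minus_greater[of "b - a"] assms by simp
  finally show ?thesis .
qed

text \<open>Since \<open>exp\<close> has modulus at most \<open>1\<close> on the closed left half plane, with equality only on the
  boundary, it strictly contracts distances there. A Gerstner wave displaces each particle by the
  value of such an exponential, so no two particles can be moved to the same point.\<close>

lemma exp_polar_contraction:
  fixes a b \<alpha> \<beta> :: real
  assumes "a \<le> 0" "b \<le> 0" "a \<noteq> b \<or> \<alpha> \<noteq> \<beta>"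
  shows "(exp a * cos \<alpha> - exp b * cos \<beta>)\<^sup>2 + (exp a * sin \<alpha> - exp b * sin \<beta>)\<^sup>2
    < (a - b)\<^sup>2 + (\<alpha> - \<beta>)\<^sup>2"
proof -
  let ?s = "sin ((\<alpha> - \<beta>) / 2)"
  have polar: "(x * cos \<alpha> - y * cos \<beta>)\<^sup>2 + (x * sin \<alpha> - y * sin \<beta>)\<^sup>2 = (x - y)\<^sup>2 + x * y * (2 * ?s)\<^sup>2"
    for x y :: real
  proof -
    have expand: "(x * c - y * d)\<^sup>2 + (x * s - y * t)\<^sup>2
        = x\<^sup>2 * (c\<^sup>2 + s\<^sup>2) + y\<^sup>2 * (d\<^sup>2 + t\<^sup>2) - 2 * x * y * (c * d + s * t)" for c d s t :: real
      by (simp add: power2_eq_square algebra_simps)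
    have "2 * ((\<alpha> - \<beta>) / 2) = \<alpha> - \<beta>" by simp
    then have "cos (\<alpha> - \<beta>) = 1 - 2 * ?s\<^sup>2" by (metis cos_double_sin)
    then have "(2 * ?s)\<^sup>2 = 2 * (1 - (cos \<alpha> * cos \<beta> + sin \<alpha> * sin \<beta>))"
      by (simp add: cos_diff power_mult_distrib)
    moreover have "(x * cos \<alpha> - y * cos \<beta>)\<^sup>2 + (x * sin \<alpha> - y * sin \<beta>)\<^sup>2
        = x\<^sup>2 * ((cos \<alpha>)\<^sup>2 + (sin \<alpha>)\<^sup>2) + y\<^sup>2 * ((cos \<beta>)\<^sup>2 + (sin \<beta>)\<^sup>2)
          - 2 * x * y * (cos \<alpha> * cos \<beta> + sin \<alpha> * sin \<beta>)"
      by (rule expand)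
    ultimately show ?thesis
      by (simp only: sin_cos_squared_add2 power2_diff) (simp add: algebra_simps)
  qed
  have radial: "\<bar>exp a - exp b\<bar> \<le> \<bar>a - b\<bar>" and radial': "a \<noteq> b \<Longrightarrow> \<bar>exp a - exp b\<bar> < \<bar>a - b\<bar>"
    using exp_diff_less[of a b] exp_diff_less[of b a] assms(1,2)
    by (cases a b rule: linorder_cases; simp add: abs_if)+
  have angular: "(2 * ?s)\<^sup>2 \<le> (\<alpha> - \<beta>)\<^sup>2" and angular': "\<alpha> \<noteq> \<beta> \<Longrightarrow> (2 * ?s)\<^sup>2 < (\<alpha> - \<beta>)\<^sup>2"
  proof -
    show lt: "(2 * ?s)\<^sup>2 < (\<alpha> - \<beta>)\<^sup>2" if "\<alpha> \<noteq> \<beta>"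
      using abs_sin_less_abs[of "(\<alpha> - \<beta>) / 2"] that
      by (intro power2_strict_mono) (simp add: abs_mult)
    show "(2 * ?s)\<^sup>2 \<le> (\<alpha> - \<beta>)\<^sup>2" by (cases "\<alpha> = \<beta>") (use lt in auto)
  qed
  have "exp a * exp b * (2 * ?s)\<^sup>2 \<le> (2 * ?s)\<^sup>2"
    using assms(1,2) by (intro mult_left_le_one_le) (auto simp: mult_le_one)
  moreover have "(exp a - exp b)\<^sup>2 \<le> (a - b)\<^sup>2" using radial by (simp add: abs_le_square_iff)
  moreover have "(exp a - exp b)\<^sup>2 < (a - b)\<^sup>2 \<or> (2 * ?s)\<^sup>2 < (\<alpha> - \<beta>)\<^sup>2"
    using assms(3) radial' angular' by (auto intro: power2_strict_mono)
  ultimately show ?thesis unfolding polar using angular by linarith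
qed

text \<open>In units of \<open>1 / k\<close> and relative to \<open>f s\<close>, this is the height above mean anomaly \<open>M\<close> of the curve
  formed by the particles with \<open>k (r - f s) = a\<close>: their abscissas satisfy Kepler's equation with
  eccentricity \<open>exp a\<close>.\<close>

definition trochoid :: "real \<Rightarrow> real \<Rightarrow> real" where
  "trochoid M a = a + exp a * cos (kepler M (exp a))"

lemma trochoid_inj:
  assumes "a \<le> 0" "b \<le> 0" "trochoid M a = trochoid M b"
  shows "a = b"
proof (rule ccontr)
  assume "a \<noteq> b"
  let ?\<alpha> = "kepler M (exp a)" and ?\<beta> = "kepler M (exp b)"
  have "?\<alpha> - exp a * sin ?\<alpha> = ?\<beta> - exp b * sin ?\<beta>"
    using assms(1,2) kepler_eq[of "exp a" M] kepler_eq[of "exp b" M] by simp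
  then have "exp a * sin ?\<alpha> - exp b * sin ?\<beta> = ?\<alpha> - ?\<beta>" by simp
  moreover have "exp a * cos ?\<alpha> - exp b * cos ?\<beta> = - (a - b)"
    using assms(3) by (simp add: trochoid_def)
  ultimately show False
    using exp_polar_contraction[of a b ?\<alpha> ?\<beta>] assms(1,2) \<open>a \<noteq> b\<close> by (simp add: power2_commute)
qed

lemma continuous_on_trochoid: "continuous_on (UNIV \<times> {..0}) (\<lambda>p. trochoid (fst p) (snd p))"
proof -
  have "continuous_on (UNIV \<times> {..0::real}) (\<lambda>p. kepler (fst (fst p, exp (snd p))) (snd (fst p, exp (snd p))))"
    by (rule continuous_on_compose2[OF continuous_on_kepler]) (auto intro!: continuous_intros)
  then show ?thesis unfolding trochoid_def by (auto intro!: continuous_intros)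
qed

lemma smooth_on_trochoid:
  "smooth_on {p. snd p \<le> 0 \<and> (snd p = 0 \<longrightarrow> fst p \<notin> range (\<lambda>n::int. of_int n * (2 * pi)))}
     (\<lambda>p. trochoid (fst p) (snd p))"
  (is "smooth_on ?S _")
proof -
  have "smooth_on ?S (\<lambda>p. kepler (fst (fst p, exp (snd p))) (snd (fst p, exp (snd p))))"
    by (rule smooth_on_compose[OF smooth_on_kepler]) (auto intro!: smooth_intros)
  then have "smooth_on ?S (\<lambda>p. kepler (fst p) (exp (snd p)))" by simp
  then show ?thesis
    unfolding trochoid_def
    by (intro smooth_on_add smooth_on_mult smooth_on_exp smooth_on_cos smooth_on_snd smooth_on_ident)
qed

text \<open>For a fixed mean anomaly the height of the trochoid is continuous and injective in \<open>a\<close> and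
  tends to \<open>-\<infinity>\<close> with \<open>a\<close>, so the trochoids with labels below \<open>b\<close> sweep exactly the points below
  the trochoid with label \<open>b\<close>.\<close>

lemma trochoid_below_iff:
  assumes b: "b \<le> 0"
  shows "(\<exists>a<b. h = trochoid M a) \<longleftrightarrow> h < trochoid M b"
proof -
  have "continuous_on {..0} (\<lambda>a. trochoid (fst (M, a)) (snd (M, a)))"
    by (rule continuous_on_compose2[OF continuous_on_trochoid]) (auto intro!: continuous_intros)
  then have "continuous_on {..0} (trochoid M)" by simp
  then have cont: "continuous_on {x..b} (trochoid M)" for x
    by (rule continuous_on_subset) (use b in auto)
  have upper: "trochoid M a \<le> a + 1" if "a \<le> 0" for a
  proof -
    have "exp a * cos (kepler M (exp a)) \<le> exp a" by (simp add: mult_left_le)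
    also have "\<dots> \<le> 1" using that by simp
    finally show ?thesis by (simp add: trochoid_def)
  qed
  have attained: "\<exists>a<b'. h = trochoid M a" if b': "b' \<le> b" and h: "h < trochoid M b'" for b' h
  proof -
    define l where "l = min (b' - 1) (h - 1)"
    have "l \<le> b' - 1" "l \<le> h - 1" by (auto simp: l_def)
    then have "trochoid M l \<le> h" using upper[of l] b b' by linarith
    moreover have "continuous_on {l..b'} (trochoid M)" using b' by (intro continuous_on_subset[OF cont[of l]]) auto
    ultimately have "\<exists>a\<ge>l. a \<le> b' \<and> trochoid M a = h"
      using h \<open>l \<le> b' - 1\<close> by (intro IVT') auto
    then obtain a where "l \<le> a" "a \<le> b'" "trochoid M a = h" by blast
    moreover from this have "a \<noteq> b'" using h by auto
    ultimately show ?thesis by force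
  qed
  have "trochoid M a < trochoid M b" if a: "a < b" for a
  proof (rule ccontr)
    assume "\<not> trochoid M a < trochoid M b"
    moreover have "trochoid M a \<noteq> trochoid M b" using trochoid_inj[of a b M] a b by auto
    ultimately obtain a' where "a' < a" "trochoid M b = trochoid M a'"
      using attained[of a "trochoid M b"] a by auto
    then show False using trochoid_inj[of b a' M] a b by simp
  qed
  then show ?thesis using attained[of b h] by blast
qed

section \<open>The fold of the exponential function\<close>

lemma exp_gt_add_one: "w \<noteq> 0 \<Longrightarrow> 1 + w < exp w" for w :: real
  using exp_minus_greater[of "- w"] by simp

text \<open>The function \<open>\<phi> w = exp w - 1 - w\<close> has a nondegenerate minimum at \<open>0\<close>, so
  \<open>\<phi> w = w\<^sup>2 h w\<close> with an entire positive \<open>h\<close>, and \<open>\<psi> w = w sqrt (2 h w)\<close> is a smooth coordinate in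
  which \<open>\<phi>\<close> is exactly \<open>\<psi>\<^sup>2 / 2\<close>. Its inverse \<open>W\<close> is the branch \<open>w \<le> 0\<close> of the inverse of \<open>\<phi>\<close>, written
  as a function of \<open>- sqrt (2 \<phi> w)\<close> that extends smoothly across the fold point.\<close>

lemma exp_fold_inverse:
  obtains V and W :: "real \<Rightarrow> real" where "open V" "smooth_on V W"
    "\<And>w. w \<le> 0 \<Longrightarrow> - sqrt (2 * (exp w - 1 - w)) \<in> V"
    "\<And>w. w \<le> 0 \<Longrightarrow> W (- sqrt (2 * (exp w - 1 - w))) = w"
proof -
  define h where "h w = (\<Sum>n. inverse (fact (n + 2)) * w ^ n)" for w :: real
  have summ: "summable (\<lambda>n. inverse (fact (n + 2)) * w ^ n)" for w :: real
  proof (cases "w = 0")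
    case False
    have "summable (\<lambda>n. inverse (fact (n + 2)) * w ^ (n + 2))"
      using summable_exp[of w] by (subst summable_iff_shift)
    then have "summable (\<lambda>n. inverse (fact (n + 2)) * w ^ (n + 2) * inverse (w\<^sup>2))"
      by (rule summable_mult2)
    moreover have "inverse (fact (n + 2)) * w ^ (n + 2) * inverse (w\<^sup>2) = inverse (fact (n + 2)) * w ^ n" for n
      using False by (simp add: power_add del: fact_Suc add_2_eq_Suc')
    ultimately show ?thesis by (simp only:)
  qed simp
  have h: "w\<^sup>2 * h w = exp w - 1 - w" for w
  proof -
    have "exp w = (\<Sum>n. inverse (fact (n + 2)) * w ^ (n + 2)) + (\<Sum>n<2. inverse (fact n) * w ^ n)"
      using suminf_split_initial_segment[OF summable_exp[of w], of 2]
      by (simp add: exp_def divide_inverse mult.commute)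
    also have "(\<Sum>n. inverse (fact (n + 2)) * w ^ (n + 2)) = w\<^sup>2 * h w"
      unfolding h_def suminf_mult[OF summ, symmetric] by (simp add: power_add mult_ac power2_eq_square)
    finally show ?thesis by (simp add: numeral_2_eq_2)
  qed
  have h0: "h 0 = 1 / 2"
    unfolding h_def using powser_zero[of "\<lambda>n. inverse (fact (n + 2) :: real)"] by (simp add: fact_numeral)
  have hpos: "h w > 0" for w
  proof (cases "w = 0")
    case False
    then have "w\<^sup>2 * h w > 0" using h[of w] exp_gt_add_one[of w] by simp
    then show ?thesis by (simp add: zero_less_mult_iff)
  qed (simp add: h0)
  define \<psi> where "\<psi> w = w * sqrt (2 * h w)" for w
  have smooth_h: "smooth_on S h" for S unfolding h_def by (rule smooth_on_entire_series[OF summ])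
  have smooth_root: "smooth_on UNIV (\<lambda>w. sqrt (2 * h w))"
    using hpos by (intro smooth_intros smooth_h) simp
  then have smooth: "smooth_on UNIV \<psi>" unfolding \<psi>_def by (rule smooth_on_mult[OF smooth_on_ident])
  have sq: "(\<psi> w)\<^sup>2 = 2 * (exp w - 1 - w)" for w
    unfolding h[symmetric] \<psi>_def using hpos[of w] by (simp add: power_mult_distrib)
  have sgn: "\<psi> w > 0 \<longleftrightarrow> w > 0" "\<psi> w < 0 \<longleftrightarrow> w < 0" for w
    using hpos[of w] by (auto simp: \<psi>_def zero_less_mult_iff mult_less_0_iff)
  define \<psi>' where "\<psi>' w = frechet_derivative \<psi> (at w) 1" for w
  have frechet: "(f has_real_derivative frechet_derivative f (at w) 1) (at w)"
    if "smooth_on UNIV f" for f :: "real \<Rightarrow> real" and w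
  proof -
    have "Ck_on (Suc 0) UNIV f" using that smooth_on_open_iff[OF open_UNIV] by blast
    then have "f differentiable (at w)" by simp
    then obtain D where "(f has_real_derivative D) (at w)" by (auto simp: real_differentiable_def)
    moreover from this have "frechet_derivative f (at w) = (*) D"
      unfolding has_field_derivative_def by (rule frechet_derivative_at[symmetric])
    ultimately show ?thesis by simp
  qed
  have der: "(\<psi> has_real_derivative \<psi>' w) (at w)" for w
    unfolding \<psi>'_def by (rule frechet[OF smooth])
  have pos: "\<psi>' w > 0" for w
  proof (cases "w = 0")
    case True
    obtain d where "((\<lambda>w. sqrt (2 * h w)) has_real_derivative d) (at 0)" using frechet[OF smooth_root] by blast
    \<comment> \<open>At the fold \<open>\<psi>\<^sup>2\<close> carries no first order information, but the factor \<open>w\<close> of \<open>\<psi>\<close> does.\<close>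
    from DERIV_mult[OF DERIV_ident this] have "(\<psi> has_real_derivative 1) (at 0)"
      unfolding \<psi>_def by (simp add: h0)
    then show ?thesis using der[of 0] DERIV_unique True by fastforce
  next
    case False
    have "((\<lambda>w. (\<psi> w)\<^sup>2) has_real_derivative 2 * \<psi> w * \<psi>' w) (at w)"
      by (auto intro!: derivative_eq_intros der)
    moreover have "((\<lambda>w. (\<psi> w)\<^sup>2) has_real_derivative 2 * (exp w - 1)) (at w)"
      unfolding sq by (auto intro!: derivative_eq_intros)
    ultimately have "\<psi> w * \<psi>' w = exp w - 1" using DERIV_unique by fastforce
    moreover have "exp w - 1 > 0 \<longleftrightarrow> w > 0" "exp w - 1 < 0 \<longleftrightarrow> w < 0" by simp_all
    ultimately show ?thesis
      using False sgn[of w] zero_less_mult_iff[of "\<psi> w" "\<psi>' w"] mult_less_0_iff[of "\<psi> w" "\<psi>' w"]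
      by linarith
  qed
  have mono: "\<psi> x < \<psi> y" if "x < y" for x y
    using that by (rule DERIV_pos_imp_increasing) (use der pos in blast)
  have inj: "inj \<psi>" by (rule linorder_injI) (use mono less_imp_neq in blast)
  have "diffeomorphism_on UNIV (range \<psi>) \<psi>"
  proof (rule diffeomorphism_onI[OF _ smooth inj])
    show "(\<psi> has_derivative (*) (\<psi>' w)) (at w)" for w
      using der by (simp add: has_field_derivative_def)
    show "smooth_on UNIV (\<lambda>w. v / \<psi>' w)" for v
      unfolding \<psi>'_def
      by (rule smooth_on_divide[OF smooth_on_const smooth_on_frechet_derivative[OF open_UNIV smooth]])
        (use pos in \<open>simp add: \<psi>'_def less_imp_neq[symmetric]\<close>)
    show "\<psi>' w * (v / \<psi>' w) = v" for w v using pos[of w] by simp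
  qed simp
  then have W: "open (range \<psi>)" "smooth_on (range \<psi>) (inv \<psi>)" by (auto simp: diffeomorphism_on_def)
  have branch: "- sqrt (2 * (exp w - 1 - w)) = \<psi> w" if "w \<le> 0" for w
    unfolding sq[symmetric] using sgn[of w] that by (simp add: not_less)
  show ?thesis
    by (rule that[OF W]) (use branch inj in auto)
qed

section \<open>The flow map\<close>

text \<open>The left hand sides of the conclusions are the derivative of a plane Gerstner wave with
  amplitude factor \<open>e\<close> and phase \<open>(C, S) = (cos \<theta>, sin \<theta>)\<close>, so this is Cramer's rule for its Jacobian.
  The determinant \<open>1 - e\<^sup>2\<close> does not depend on the phase, because the perturbation of the identity is
  \<open>e\<close> times a reflection.\<close>

lemma gerstner_jacobian_solve:
  fixes e C S X Y :: real
  assumes "1 - e\<^sup>2 \<noteq> 0" "C\<^sup>2 + S\<^sup>2 = 1"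
    and u: "u = ((1 + e * C) * X + e * S * Y) / (1 - e\<^sup>2)"
    and w: "w = (e * S * X + (1 - e * C) * Y) / (1 - e\<^sup>2)"
  shows "u - (e * w * S + e * C * u) = X" "w + (e * w * C - e * S * u) = Y"
proof -
  have uD: "(1 - e\<^sup>2) * u = (1 + e * C) * X + e * S * Y"
    and wD: "(1 - e\<^sup>2) * w = e * S * X + (1 - e * C) * Y"
    using assms(1) u w by auto
  have "(1 - e\<^sup>2) * (u - (e * w * S + e * C * u))
      = (1 - e * C) * ((1 - e\<^sup>2) * u) - e * S * ((1 - e\<^sup>2) * w)"
    by (simp add: algebra_simps)
  also have "\<dots> = (1 - e\<^sup>2 * (C\<^sup>2 + S\<^sup>2)) * X"
    unfolding uD wD by (simp add: power2_eq_square algebra_simps)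
  finally show "u - (e * w * S + e * C * u) = X" using assms(1,2) by simp
  have "(1 - e\<^sup>2) * (w + (e * w * C - e * S * u))
      = (1 + e * C) * ((1 - e\<^sup>2) * w) - e * S * ((1 - e\<^sup>2) * u)"
    by (simp add: algebra_simps)
  also have "\<dots> = (1 - e\<^sup>2 * (C\<^sup>2 + S\<^sup>2)) * Y"
    unfolding uD wD by (simp add: power2_eq_square algebra_simps)
  finally show "w + (e * w * C - e * S * u) = Y" using assms(1,2) by simp
qed

locale edge_wave =
  fixes k c t \<gamma> r0 :: real and f :: "real \<Rightarrow> real"
  assumes k: "k > 0" and \<gamma>: "\<gamma> > 0" and r0: "r0 \<le> 0" and f_eq: "f = (\<lambda>s. \<gamma> * s\<^sup>2)"
begin

abbreviation flow :: "real \<times> real \<times> real \<Rightarrow> real \<times> real \<times> real" where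
  "flow \<equiv> flow_map k c f t"

abbreviation phase :: "real \<Rightarrow> real" where
  "phase x \<equiv> k * (x - c * t)"

lemma f_apply: "f s = \<gamma> * s\<^sup>2"
  by (simp add: f_eq)

lemma f_nonneg: "f s \<ge> 0"
  using \<gamma> by (simp add: f_apply)

lemma flow_trochoid:
  assumes "r \<le> f s" "flow (q, r, s) = (x, y, z)"
  shows "y = s" "phase q - exp (k * (r - f s)) * sin (phase q) = phase x"
    "z = f s + trochoid (phase x) (k * (r - f s)) / k"
proof -
  let ?e = "exp (k * (r - f s))"
  have e: "\<bar>?e\<bar> \<le> 1" using assms(1) k by (simp add: mult_le_0_iff)
  have xyz: "x = q - 1 / k * ?e * sin (phase q)" "y = s" "z = r + 1 / k * ?e * cos (phase q)"
    using assms(2) by (auto simp: flow_map_def)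
  show "y = s" by (fact xyz)
  show M: "phase q - ?e * sin (phase q) = phase x" using xyz k by (simp add: field_simps)
  show "z = f s + trochoid (phase x) (k * (r - f s)) / k"
  proof -
    have "trochoid (phase x) (k * (r - f s)) = k * (r - f s) + ?e * cos (phase q)"
      by (simp only: trochoid_def kepler_unique[OF e M])
    then show ?thesis using xyz(3) k by (simp add: field_simps)
  qed
qed

text \<open>For fixed \<open>r\<close> and \<open>s\<close> the particles form the graph of a function of \<open>x\<close>, because Kepler's equation
  is uniquely solvable for the label \<open>q\<close>.\<close>

lemma flow_fibre_iff:
  assumes "r \<le> f s"
  shows "(\<exists>q. flow (q, r, s) = (x, y, z)) \<longleftrightarrow> y = s \<and> z = f s + trochoid (phase x) (k * (r - f s)) / k"
proof
  assume "\<exists>q. flow (q, r, s) = (x, y, z)"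
  then show "y = s \<and> z = f s + trochoid (phase x) (k * (r - f s)) / k"
    using flow_trochoid[OF assms] by blast
next
  let ?e = "exp (k * (r - f s))"
  define \<theta> where "\<theta> = kepler (phase x) ?e"
  define q where "q = c * t + \<theta> / k"
  assume R: "y = s \<and> z = f s + trochoid (phase x) (k * (r - f s)) / k"
  have e: "\<bar>?e\<bar> \<le> 1" using assms k by (simp add: mult_le_0_iff)
  have q: "phase q = \<theta>" using k by (simp add: q_def)
  have "\<theta> - ?e * sin \<theta> = phase x" unfolding \<theta>_def by (rule kepler_eq[OF e])
  then have "x = q - 1 / k * ?e * sin \<theta>" using k by (simp add: q_def field_simps)
  moreover have "z = r + 1 / k * ?e * cos \<theta>"
  proof -
    have "trochoid (phase x) (k * (r - f s)) = k * (r - f s) + ?e * cos \<theta>"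
      by (simp only: trochoid_def \<theta>_def)
    then show ?thesis using R k by (simp add: field_simps)
  qed
  ultimately have "flow (q, r, s) = (x, y, z)" using R q by (simp add: flow_map_def)
  then show "\<exists>q. flow (q, r, s) = (x, y, z)" ..
qed

lemma flow_inj: "inj_on flow {(q, r, s). r \<le> f s}"
proof (rule inj_onI)
  fix p p'
  assume below: "p \<in> {(q, r, s). r \<le> f s}" "p' \<in> {(q, r, s). r \<le> f s}"
    and image: "flow p = flow p'"
  obtain q r s q' r' s' where p: "p = (q, r, s)" "p' = (q', r', s')" by (cases p; cases p') auto
  then have r: "r \<le> f s" "r' \<le> f s'" and eq: "flow (q, r, s) = flow (q', r', s')"
    using below image by auto
  obtain x y z where xyz: "flow (q', r', s') = (x, y, z)" by (cases "flow (q', r', s')") auto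
  note 1 = flow_trochoid[OF r(1) eq[unfolded xyz]] and 2 = flow_trochoid[OF r(2) xyz]
  have s: "s = s'" using 1(1) 2(1) by simp
  have "trochoid (phase x) (k * (r - f s)) = trochoid (phase x) (k * (r' - f s))"
    using 1(3) 2(3) k s by simp
  moreover have "k * (r - f s) \<le> 0" "k * (r' - f s) \<le> 0"
    using r s k by (simp_all add: mult_le_0_iff)
  ultimately have "k * (r - f s) = k * (r' - f s)" by (metis trochoid_inj)
  then have r': "r = r'" using k by simp
  have "\<bar>exp (k * (r' - f s'))\<bar> \<le> 1" using r(2) k by (simp add: mult_le_0_iff)
  moreover have "phase q - exp (k * (r' - f s')) * sin (phase q)
      = phase q' - exp (k * (r' - f s')) * sin (phase q')"
    using 1(2) 2(2) by (simp only: r' s)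
  ultimately have "phase q = phase q'" by (rule kepler_equation_inj)
  then show "p = p'" using p k s r' by simp
qed

lemma flow_diffeomorphism:
  assumes U: "open U" "\<And>q r s. (q, r, s) \<in> U \<Longrightarrow> r < f s"
  shows "diffeomorphism_on U (flow ` U) flow"
proof -
  define e where "e p = exp (k * (fst (snd p) - \<gamma> * (snd (snd p))\<^sup>2))" for p :: "real \<times> real \<times> real"
  define \<theta> where "\<theta> p = k * (fst p - c * t)" for p :: "real \<times> real \<times> real"
  \<comment> \<open>The latitude enters \<open>x\<close> and \<open>z\<close> only through \<open>r - f s\<close>. In terms of the variation \<open>w\<close> of \<open>r - f s\<close> the
     Jacobian is that of the plane Gerstner wave, with \<open>m\<close> transferred to the right hand side.\<close>
  define m where "m p v = 2 * \<gamma> * snd (snd p) * fst (snd v)" for p v :: "real \<times> real \<times> real"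
  have flow_eq: "flow = (\<lambda>p. (fst p - 1 / k * e p * sin (\<theta> p), snd (snd p),
      fst (snd p) + 1 / k * e p * cos (\<theta> p)))"
    by (auto simp: flow_map_def e_def \<theta>_def f_apply)
  have e1: "1 - (e p)\<^sup>2 > 0" if "p \<in> U" for p
  proof -
    have "fst (snd p) < f (snd (snd p))" using U(2) that by (cases p) auto
    then have "e p < 1" using k by (simp add: e_def f_apply mult_less_0_iff)
    then show ?thesis by (simp add: e_def abs_square_less_1)
  qed
  have smooth_e: "smooth_on U e" and smooth_\<theta>: "smooth_on U \<theta>"
    unfolding e_def \<theta>_def by (intro smooth_intros)+
  define f' where "f' p v = (let w = fst (snd v) - 2 * \<gamma> * snd (snd p) * snd (snd v) in
      (fst v - (e p * w * sin (\<theta> p) + e p * cos (\<theta> p) * fst v), snd (snd v),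
       fst (snd v) + (e p * w * cos (\<theta> p) - e p * sin (\<theta> p) * fst v)))"
    for p v :: "real \<times> real \<times> real"
  define du where "du p v = ((1 + e p * cos (\<theta> p)) * fst v
      + e p * sin (\<theta> p) * (snd (snd v) - m p v)) / (1 - (e p)\<^sup>2)" for p v
  define dw where "dw p v = (e p * sin (\<theta> p) * fst v
      + (1 - e p * cos (\<theta> p)) * (snd (snd v) - m p v)) / (1 - (e p)\<^sup>2)" for p v
  show ?thesis
  proof (rule diffeomorphism_onI[OF U(1)])
    show "smooth_on U flow"
      unfolding flow_eq by (intro smooth_intros smooth_e smooth_\<theta>)
    show "inj_on flow U"
      by (rule inj_on_subset[OF flow_inj]) (auto dest!: U(2))
    show "(flow has_derivative f' p) (at p)" for p
    proof -
      have e': "(e has_derivative (\<lambda>v. e p * (k * (fst (snd v) - 2 * \<gamma> * snd (snd p) * snd (snd v))))) (at p)"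
        unfolding e_def by (auto intro!: derivative_eq_intros)
      have \<theta>': "(\<theta> has_derivative (\<lambda>v. k * fst v)) (at p)"
        unfolding \<theta>_def by (auto intro!: derivative_eq_intros)
      show ?thesis
        unfolding flow_eq
        by (rule has_derivative_eq_rhs, (rule has_derivative_const e' \<theta>' derivative_intros)+)
          (use k in \<open>auto simp: f'_def Let_def fun_eq_iff field_simps\<close>)
    qed
    show "f' p (du p v, dw p v + m p v, fst (snd v)) = v" if "p \<in> U" for p v
    proof -
      have "1 - (e p)\<^sup>2 \<noteq> 0" using e1[OF that] by simp
      note solve = gerstner_jacobian_solve[OF this sin_cos_squared_add2[of "\<theta> p"] du_def[of p v] dw_def[of p v]]
      have "dw p v + m p v - 2 * \<gamma> * snd (snd p) * fst (snd v) = dw p v" by (simp add: m_def)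
      then show ?thesis
        using solve by (simp add: f'_def Let_def prod_eq_iff)
    qed
    show "smooth_on U (\<lambda>p. (du p v, dw p v + m p v, fst (snd v)))" for v
      unfolding du_def dw_def m_def
      by (intro smooth_intros smooth_e smooth_\<theta>) (use e1 in force)+
  qed
qed

section \<open>The free surface\<close>

abbreviation \<rho> :: "real \<Rightarrow> real" where
  "\<rho> \<equiv> surface_label k f r0"

text \<open>The exponent \<open>k (r\<^sub>0(s) - f s)\<close> of the surface particles. It is negative except at the latitude
  \<open>s = 0\<close> in the case \<open>r\<^sub>0 = 0\<close>, which is the only place where the surface can be singular.\<close>

definition exponent :: "real \<Rightarrow> real" where
  "exponent s = k * (\<rho> s - f s)"

lemma surface_label_solves:
  "\<rho> s \<le> r0 \<and> exp (2 * k * (\<rho> s - f s)) / (2 * k) - \<rho> s = exp (2 * k * r0) / (2 * k) - r0"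
  unfolding surface_label_def by (rule theI'[OF surface_label_unique[where f = f and s = s, OF k r0 f_nonneg]])

lemma surface_label_eq: "\<rho> s = f s + exponent s / k"
  using k by (simp add: exponent_def)

lemma surface_label_le: "\<rho> s \<le> f s"
  using surface_label_solves[of s] r0 f_nonneg[of s] by linarith

lemma exponent_nonpos: "exponent s \<le> 0"
  using surface_label_le[of s] k by (simp add: exponent_def mult_le_0_iff)

text \<open>The defining equation of \<open>r\<^sub>0(s)\<close>, rewritten in terms of the fold \<open>exp w - 1 - w\<close> at \<open>w = 2 exponent s\<close>.\<close>

lemma exponent_fold:
  "exp (2 * exponent s) - 1 - 2 * exponent s = (exp (2 * k * r0) - 1 - 2 * k * r0) + 2 * k * \<gamma> * s\<^sup>2"
proof -
  have "exp (2 * k * (\<rho> s - f s)) - 2 * k * \<rho> s = exp (2 * k * r0) - 2 * k * r0"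
    using surface_label_solves[of s] k by (simp add: field_simps)
  then show ?thesis by (simp add: exponent_def f_apply algebra_simps)
qed

lemma exponent_neg:
  assumes "r0 < 0 \<or> s \<noteq> 0" shows "exponent s < 0"
proof -
  have "f s > 0" if "s \<noteq> 0" using \<gamma> that by (simp add: f_apply)
  then have "\<rho> s < f s"
    using surface_label_solves[of s] r0 f_nonneg[of s] assms by linarith
  then show ?thesis using k by (simp add: exponent_def mult_less_0_iff)
qed

lemma exponent_zero: "r0 = 0 \<Longrightarrow> exponent 0 = 0"
  using exponent_fold[of 0] exp_gt_add_one[of "2 * exponent 0"] by force

lemma exponent_even: "exponent (- s) = exponent s"
  by (simp add: exponent_def surface_label_def f_apply)

text \<open>In the coordinate that straightens the fold, twice the exponent is minus the square root of a
  quadratic polynomial in \<open>s\<close>. So it is as smooth as that root.\<close>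

lemma smooth_on_exponent:
  assumes root: "smooth_on S (\<lambda>s. sqrt (2 * (exp (2 * k * r0) - 1 - 2 * k * r0) + 4 * k * \<gamma> * s\<^sup>2))"
  shows "smooth_on S exponent"
proof -
  let ?\<sigma> = "\<lambda>s. - sqrt (2 * (exp (2 * k * r0) - 1 - 2 * k * r0) + 4 * k * \<gamma> * s\<^sup>2)"
  obtain V W where W: "smooth_on V W" "\<And>w. w \<le> 0 \<Longrightarrow> - sqrt (2 * (exp w - 1 - w)) \<in> V"
      "\<And>w. w \<le> 0 \<Longrightarrow> W (- sqrt (2 * (exp w - 1 - w))) = w"
    using exp_fold_inverse by metis
  have \<sigma>: "?\<sigma> s = - sqrt (2 * (exp (2 * exponent s) - 1 - 2 * exponent s))" for s
    unfolding exponent_fold by (simp add: algebra_simps)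
  have "smooth_on S (\<lambda>s. W (?\<sigma> s))"
    by (rule smooth_on_compose[OF W(1) smooth_on_minus[OF root]])
      (unfold \<sigma>, rule W(2), simp add: exponent_nonpos)
  then have "smooth_on S (\<lambda>s. W (?\<sigma> s) / 2)" by (intro smooth_on_divide smooth_on_const) auto
  moreover have "W (?\<sigma> s) = 2 * exponent s" for s
    unfolding \<sigma> by (rule W(3)) (simp add: exponent_nonpos)
  ultimately show ?thesis by simp
qed

lemma smooth_on_exponent_neg:
  assumes "r0 < 0" shows "smooth_on UNIV exponent"
proof (intro smooth_on_exponent smooth_intros)
  have "exp (2 * k * r0) - 1 - 2 * k * r0 > 0"
    using exp_gt_add_one[of "2 * k * r0"] k assms by simp
  then show "2 * (exp (2 * k * r0) - 1 - 2 * k * r0) + 4 * k * \<gamma> * s\<^sup>2 > 0" for s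
    using k \<gamma> by (simp add: add_pos_nonneg)
qed

text \<open>For \<open>r\<^sub>0 = 0\<close> the quadratic polynomial is a perfect square and its root is a multiple of \<open>\<bar>s\<bar>\<close>. This is
  why the surface is only piecewise smooth, with a ridge along \<open>s = 0\<close>.\<close>

lemma smooth_on_exponent_half_line:
  assumes "r0 = 0" shows "smooth_on {0..} exponent" "smooth_on {..0} exponent"
proof -
  have "smooth_on {0..} (\<lambda>s. sqrt (4 * k * \<gamma>) * s)" by (intro smooth_intros)
  then show pos: "smooth_on {0..} exponent"
    by (intro smooth_on_exponent, elim smooth_on_cong) (simp add: assms real_sqrt_mult)
  have "smooth_on {..0} (\<lambda>s. exponent (- s))"
    by (rule smooth_on_compose[OF pos]) (auto intro: smooth_intros)
  then show "smooth_on {..0} exponent" by (simp add: exponent_even)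
qed

lemma continuous_on_exponent: "continuous_on UNIV exponent"
proof (cases "r0 < 0")
  case True
  then show ?thesis by (intro smooth_on_imp_continuous_on smooth_on_exponent_neg)
next
  case False
  then have "r0 = 0" using r0 by simp
  then have "continuous_on ({..0} \<union> {0..}) exponent"
    by (intro continuous_on_closed_Un smooth_on_imp_continuous_on smooth_on_exponent_half_line) auto
  moreover have "{..0} \<union> {0..} = (UNIV :: real set)" by auto
  ultimately show ?thesis by simp
qed

definition elevation :: "real \<times> real \<Rightarrow> real" where
  "elevation p = f (snd p) + trochoid (phase (fst p)) (exponent (snd p)) / k"

lemma free_surface_eq: "free_surface k c f r0 t = {(x, y, z). z = elevation (x, y)}"
proof -
  have "(x, y, z) \<in> free_surface k c f r0 t \<longleftrightarrow> z = elevation (x, y)" for x y z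
  proof -
    have "(x, y, z) \<in> free_surface k c f r0 t \<longleftrightarrow> (\<exists>s q. flow (q, \<rho> s, s) = (x, y, z))"
    proof
      assume "(x, y, z) \<in> free_surface k c f r0 t"
      then obtain p where "(x, y, z) = (\<lambda>(q, s). flow (q, \<rho> s, s)) p"
        unfolding free_surface_def by (rule rangeE)
      then have "flow (fst p, \<rho> (snd p), snd p) = (x, y, z)" by (simp add: case_prod_beta)
      then show "\<exists>s q. flow (q, \<rho> s, s) = (x, y, z)" by blast
    next
      assume "\<exists>s q. flow (q, \<rho> s, s) = (x, y, z)"
      then obtain s q where "flow (q, \<rho> s, s) = (x, y, z)" by blast
      then show "(x, y, z) \<in> free_surface k c f r0 t"
        unfolding free_surface_def by (intro range_eqI[of _ _ "(q, s)"]) simp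
    qed
    then show ?thesis
      unfolding flow_fibre_iff[OF surface_label_le] by (auto simp: elevation_def exponent_def)
  qed
  then show ?thesis by auto
qed

lemma fluid_labels_iff: "(q, r, s) \<in> fluid_labels k f r0 \<longleftrightarrow> r < \<rho> s"
  using surface_label_solves[of s] by (auto simp: fluid_labels_def label_domain_def)

lemma fluid_domain_eq: "fluid_domain k c f r0 t = flow ` fluid_labels k f r0"
proof -
  have "(x, y, z) \<in> flow ` fluid_labels k f r0 \<longleftrightarrow> z < elevation (x, y)" for x y z
  proof -
    let ?M = "phase x"
    have fibre: "(\<exists>q. flow (q, r, s) = (x, y, z)) \<longleftrightarrow> y = s \<and> k * (z - f s) = trochoid ?M (k * (r - f s))"
      if "r < \<rho> s" for r s
    proof -
      have "r \<le> f s" using that surface_label_le[of s] by simp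
      moreover have "z = f s + T / k \<longleftrightarrow> k * (z - f s) = T" for T using k by (auto simp: field_simps)
      ultimately show ?thesis by (simp only: flow_fibre_iff)
    qed
    have "(x, y, z) \<in> flow ` fluid_labels k f r0 \<longleftrightarrow> (\<exists>q r s. r < \<rho> s \<and> flow (q, r, s) = (x, y, z))"
      by (simp only: image_iff Bex_def split_paired_Ex fluid_labels_iff eq_commute[of "(x, y, z)"])
    also have "\<dots> \<longleftrightarrow> (\<exists>r s. r < \<rho> s \<and> (\<exists>q. flow (q, r, s) = (x, y, z)))" by blast
    also have "\<dots> \<longleftrightarrow> (\<exists>r<\<rho> y. k * (z - f y) = trochoid ?M (k * (r - f y)))"
      using fibre by blast
    also have "\<dots> \<longleftrightarrow> (\<exists>a<exponent y. k * (z - f y) = trochoid ?M a)"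
    proof
      assume "\<exists>r<\<rho> y. k * (z - f y) = trochoid ?M (k * (r - f y))"
      then obtain r where "r < \<rho> y" "k * (z - f y) = trochoid ?M (k * (r - f y))" by blast
      then show "\<exists>a<exponent y. k * (z - f y) = trochoid ?M a"
        using k by (intro exI[of _ "k * (r - f y)"]) (simp add: exponent_def)
    next
      assume "\<exists>a<exponent y. k * (z - f y) = trochoid ?M a"
      then obtain a where "a < exponent y" "k * (z - f y) = trochoid ?M a" by blast
      then show "\<exists>r<\<rho> y. k * (z - f y) = trochoid ?M (k * (r - f y))"
        using k by (intro exI[of _ "f y + a / k"]) (simp add: surface_label_eq divide_strict_right_mono)
    qed
    also have "\<dots> \<longleftrightarrow> k * (z - f y) < trochoid ?M (exponent y)"
      by (rule trochoid_below_iff[OF exponent_nonpos])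
    also have "\<dots> \<longleftrightarrow> z < elevation (x, y)"
      using k by (simp add: elevation_def field_simps)
    finally show ?thesis .
  qed
  then show ?thesis by (auto simp: fluid_domain_def free_surface_eq)
qed

lemma smooth_on_elevation:
  assumes "smooth_on T exponent" "snd ` S \<subseteq> T"
    and "\<And>x y n. (x, y) \<in> S \<Longrightarrow> exponent y = 0 \<Longrightarrow> phase x \<noteq> of_int n * (2 * pi)"
  shows "smooth_on S elevation"
proof -
  have E: "smooth_on S (\<lambda>p. exponent (snd p))"
    by (rule smooth_on_compose[OF assms(1)]) (use assms(2) in \<open>auto intro!: smooth_intros\<close>)
  have "smooth_on S (\<lambda>p. trochoid (fst (phase (fst p), exponent (snd p))) (snd (phase (fst p), exponent (snd p))))"
    by (rule smooth_on_compose[OF smooth_on_trochoid])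
      (use assms(3) in \<open>auto intro!: smooth_intros E exponent_nonpos\<close>)
  then have "smooth_on S (\<lambda>p. trochoid (phase (fst p)) (exponent (snd p)))" by simp
  then have "smooth_on S (\<lambda>p. \<gamma> * (snd p)\<^sup>2 + trochoid (phase (fst p)) (exponent (snd p)) / k)"
    using k by (intro smooth_on_add smooth_on_divide smooth_on_mult smooth_on_power smooth_on_const
        smooth_on_snd smooth_on_ident) auto
  then show ?thesis by (simp add: elevation_def[abs_def] f_apply)
qed

lemma continuous_on_elevation: "continuous_on UNIV elevation"
proof -
  have "continuous_on UNIV (\<lambda>p. exponent (snd p))"
    by (rule continuous_on_compose2[OF continuous_on_exponent]) (auto intro!: continuous_intros)
  then have "continuous_on UNIV (\<lambda>p. trochoid (fst (phase (fst p), exponent (snd p))) (snd (phase (fst p), exponent (snd p))))"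
    by (intro continuous_on_compose2[OF continuous_on_trochoid] continuous_intros) (auto intro: exponent_nonpos)
  then show ?thesis
    unfolding elevation_def[abs_def] f_apply using k by (auto intro!: continuous_intros)
qed

lemma open_label_domain: "open (label_domain r0)"
proof -
  have "label_domain r0 = {p. fst (snd p) < r0}" by (auto simp: label_domain_def)
  then show ?thesis by (auto intro!: open_Collect_less continuous_intros)
qed

lemma open_fluid_labels: "open (fluid_labels k f r0)"
proof -
  have "continuous_on UNIV (\<lambda>p::real \<times> real \<times> real. exponent (snd (snd p)))"
    by (rule continuous_on_compose2[OF continuous_on_exponent]) (auto intro!: continuous_intros)
  then have "open {p :: real \<times> real \<times> real. fst (snd p) < \<gamma> * (snd (snd p))\<^sup>2 + exponent (snd (snd p)) / k}"
    using k by (intro open_Collect_less continuous_intros) auto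
  moreover have "fluid_labels k f r0 = label_domain r0 \<inter> {p. fst (snd p) < \<gamma> * (snd (snd p))\<^sup>2 + exponent (snd (snd p)) / k}"
    by (auto simp: fluid_labels_def surface_label_eq f_apply)
  ultimately show ?thesis using open_label_domain by auto
qed

lemma label_domain_below: "(q, r, s) \<in> label_domain r0 \<Longrightarrow> r < f s"
  using r0 f_nonneg[of s] by (simp add: label_domain_def)

end

theorem proposition3p3:
  fixes \<Omega> g R L k \<beta> c r0 t :: real and f :: "real \<Rightarrow> real"
  assumes "\<Omega> > 0" and "g > 0" and "R > 0" and "L > 0"
    and "\<beta> = 2 * \<Omega> / R"
    and "k = 2 * pi / L"
    and "c = (sqrt (\<Omega>\<^sup>2 + k * g) - \<Omega>) / k"
    and "f = (\<lambda>s. c * \<beta> / (2 * g) * s\<^sup>2)"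
    and "t \<ge> 0" and "r0 \<le> 0"
  shows "diffeomorphism_on (label_domain r0) (flow_map k c f t ` label_domain r0) (flow_map k c f t)
    \<and> diffeomorphism_on (fluid_labels k f r0) (fluid_domain k c f r0 t) (flow_map k c f t)
    \<and> (\<exists>\<eta> :: real \<times> real \<Rightarrow> real.
         free_surface k c f r0 t = {(x, y, z). z = \<eta> (x, y)}
       \<and> (r0 < 0 \<longrightarrow> smooth_on UNIV \<eta>)
       \<and> (r0 = 0 \<longrightarrow>
            continuous_on UNIV \<eta>
          \<and> smooth_on ({(x, y). y \<ge> 0} - range (\<lambda>n::int. (c * t + of_int n * L, 0))) \<eta>
          \<and> smooth_on ({(x, y). y \<le> 0} - range (\<lambda>n::int. (c * t + of_int n * L, 0))) \<eta>
          \<and> (\<forall>n::int. upward_cusp (\<lambda>x. \<eta> (x, 0)) (c * t + of_int n * L))))"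
proof -
  have k: "k > 0" using assms(4,6) by simp
  have L: "L = 2 * pi / k" using assms(4,6) by simp
  have "sqrt (\<Omega>\<^sup>2 + k * g) > sqrt (\<Omega>\<^sup>2)" using k assms(2) by (intro real_sqrt_less_mono) simp
  then have "c > 0" using k assms(1,7) by simp
  then have \<gamma>: "c * \<beta> / (2 * g) > 0" using assms(1,2,3,5) by simp
  interpret edge_wave k c t "c * \<beta> / (2 * g)" r0 f
    using k \<gamma> assms(8,10) by unfold_locales
  have not_cusp: "phase x \<noteq> of_int n * (2 * pi)"
    if r0: "r0 = 0" and xy: "(x, y) \<notin> range (\<lambda>n::int. (c * t + of_int n * L, 0))" and y: "exponent y = 0"
    for x y n
  proof
    assume "phase x = of_int n * (2 * pi)"
    then have "x = c * t + of_int n * L" using k by (simp add: L field_simps)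
    moreover have "y = 0" using exponent_neg[of y] y by auto
    ultimately show False using xy by auto
  qed
  have cusp: "upward_cusp (\<lambda>x. elevation (x, 0)) (c * t + of_int n * L)" if "r0 = 0" for n :: int
    using upward_cusp_cycloid[OF k, of "c * t" n] exponent_zero[OF that]
    by (simp add: elevation_def trochoid_def f_apply L)
  show ?thesis
  proof (intro conjI exI[of _ elevation] impI allI)
    show "diffeomorphism_on (label_domain r0) (flow ` label_domain r0) flow"
      using open_label_domain label_domain_below by (rule flow_diffeomorphism)
    show "diffeomorphism_on (fluid_labels k f r0) (fluid_domain k c f r0 t) flow"
      unfolding fluid_domain_eq
      by (intro flow_diffeomorphism open_fluid_labels label_domain_below) (auto simp: fluid_labels_def)
    show "free_surface k c f r0 t = {(x, y, z). z = elevation (x, y)}" by (rule free_surface_eq)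
    show "smooth_on UNIV elevation" if "r0 < 0"
      by (rule smooth_on_elevation[OF smooth_on_exponent_neg[OF that]])
        (use exponent_neg that in \<open>auto simp: less_imp_neq\<close>)
    assume r0: "r0 = 0"
    show "continuous_on UNIV elevation" by (rule continuous_on_elevation)
    show "smooth_on ({(x, y). y \<ge> 0} - range (\<lambda>n::int. (c * t + of_int n * L, 0))) elevation"
      by (rule smooth_on_elevation[OF smooth_on_exponent_half_line(1)[OF r0]])
        (use not_cusp[OF r0] in auto)
    show "smooth_on ({(x, y). y \<le> 0} - range (\<lambda>n::int. (c * t + of_int n * L, 0))) elevation"
      by (rule smooth_on_elevation[OF smooth_on_exponent_half_line(2)[OF r0]])
        (use not_cusp[OF r0] in auto)
    show "upward_cusp (\<lambda>x. elevation (x, 0)) (c * t + of_int n * L)" for n :: int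
      using r0 by (rule cusp)
  qed
qed

end
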